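(* There is a $2$-category $\mathbf{2Term3\text{-}Lie_\infty}$ with $2$-term $3$-$Lie_\infty$-algebras as objects, $3$-$Lie_\infty$-homomorphisms as morphisms, and $3$-$Lie_\infty$-$2$-homomorphisms as $2$-morphisms (with the compositions and identities specified in the context).
   Context: Vector spaces are over a fixed base field. Objects. A $2$-term $3$-$Lie_\infty$-algebra $\mathcal V=(V_1,V_0,\mathrm d,l_3,l_5)$ consists of a complex of vector spaces $V_1\xrightarrow{\mathrm d}V_0$; completely skew-symmetric trilinear maps $l_3:V_i\times V_j\times V_k\to V_{i+j+k}$, $0\le i+j+k\le1$; and a multilinear map $l_5:(V_0\wedge V_0)\otimes(V_0\wedge V_0\wedge V_0)\to V_1$, such that for all $x,y,x_i\in V_0$, $f,g,h\in V_1$: (a) $\mathrm d l_3(x,y,f)=l_3(x,y,\mathrm df)$; (b) $l_3(f,g,h)=0$ and $l_3(f,g,x)=0$; (c) $l_3(\mathrm df,g,x)=l_3(f,\mathrm dg,x)$; (d) $\mathrm d l_5(x_1,x_2,x_3,x_4,x_5)=-l_3(x_1,x_2,l_3(x_3,x_4,x_5))+l_3(x_3,l_3(x_1,x_2,x_4),x_5)+l_3(l_3(x_1,x_2,x_3),x_4,x_5)+l_3(x_3,x_4,l_3(x_1,x_2,x_5))$; (e) $l_5(\mathrm df,x_2,x_3,x_4,x_5)=-l_3(f,x_2,l_3(x_3,x_4,x_5))+l_3(x_3,l_3(f,x_2,x_4),x_5)+l_3(l_3(f,x_2,x_3),x_4,x_5)+l_3(x_3,x_4,l_3(f,x_2,x_5))$;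 (f) $l_5(x_1,x_2,\mathrm df,x_4,x_5)=-l_3(x_1,x_2,l_3(f,x_4,x_5))+l_3(f,l_3(x_1,x_2,x_4),x_5)+l_3(l_3(x_1,x_2,f),x_4,x_5)+l_3(f,x_4,l_3(x_1,x_2,x_5))$; (g) $l_3(l_5(x_1,x_2,x_3,x_4,x_5),x_6,x_7)+l_3(x_5,l_5(x_1,x_2,x_3,x_4,x_6),x_7)+l_3(x_1,x_2,l_5(x_3,x_4,x_5,x_6,x_7))+l_3(x_5,x_6,l_5(x_1,x_2,x_3,x_4,x_7))+l_5(x_1,x_2,l_3(x_3,x_4,x_5),x_6,x_7)+l_5(x_1,x_2,x_5,l_3(x_3,x_4,x_6),x_7)+l_5(x_1,x_2,x_5,x_6,l_3(x_3,x_4,x_7))$ $=l_3(x_3,x_4,l_5(x_1,x_2,x_5,x_6,x_7))+l_5(l_3(x_1,x_2,x_3),x_4,x_5,x_6,x_7)+l_5(x_3,l_3(x_1,x_2,x_4),x_5,x_6,x_7)+l_5(x_3,x_4,l_3(x_1,x_2,x_5),x_6,x_7)+l_5(x_3,x_4,x_5,l_3(x_1,x_2,x_6),x_7)+l_5(x_1,x_2,x_3,x_4,l_3(x_5,x_6,x_7))+l_5(x_3,x_4,x_5,x_6,l_3(x_1,x_2,x_7))$. Morphisms. A $3$-$Lie_\infty$-homomorphism $\phi:\mathcal V\to\mathcal V'$ consists of a chain map $(\phi_0:V_0\to V_0',\ \phi_1:V_1\to V_1')$ and a completely skew-symmetric trilinear $\phi_2:V_0\times V_0\times V_0\to V_1'$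 with, for $x_i\in V_0$, $h\in V_1$: $\mathrm d'\phi_2(x_1,x_2,x_3)=\phi_0(l_3(x_1,x_2,x_3))-l_3'(\phi_0(x_1),\phi_0(x_2),\phi_0(x_3))$; $\phi_2(x_1,x_2,\mathrm dh)=\phi_1(l_3(x_1,x_2,h))-l_3'(\phi_0(x_1),\phi_0(x_2),\phi_1(h))$; $l_5'(\phi_0(x_1),\dots,\phi_0(x_5))+l_3'(\phi_2(x_1,x_2,x_3),\phi_0(x_4),\phi_0(x_5))+l_3'(\phi_0(x_3),\phi_2(x_1,x_2,x_4),\phi_0(x_5))+l_3'(\phi_0(x_3),\phi_0(x_4),\phi_2(x_1,x_2,x_5))+\phi_2(l_3(x_1,x_2,x_3),x_4,x_5)+\phi_2(x_3,l_3(x_1,x_2,x_4),x_5)+\phi_2(x_3,x_4,l_3(x_1,x_2,x_5))=l_3'(\phi_0(x_1),\phi_0(x_2),\phi_2(x_3,x_4,x_5))+\phi_2(x_1,x_2,l_3(x_3,x_4,x_5))+\phi_1(l_5(x_1,\dots,x_5))$. The composite of $\varphi:\mathcal V\to\mathcal V'$ and $\psi:\mathcal V'\to\mathcal V''$ is $(\psi\circ\varphi)_0=\psi_0\varphi_0$, $(\psi\circ\varphi)_1=\psi_1\varphi_1$, $(\psi\circ\varphi)_2(x,y,z)=\psi_2(\varphi_0(x),\varphi_0(y),\varphi_0(z))+\psi_1(\varphi_2(x,y,z))$. The identity has identity chain map and zero $\phi_2$. 2-morphisms. For $\varphi,\psi:\mathcal V\to\mathcal V'$, a $3$-$Lie_\infty$-$2$-homomorphism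 $\tau:\varphi\Rightarrow\psi$ is a chain homotopy, i.e. a linear map $\tau:V_0\to V_1'$ with $\mathrm d'\tau=\psi_0-\varphi_0$, $\tau\mathrm d=\psi_1-\varphi_1$, such that for all $x_1,x_2,x_3\in V_0$ $(\varphi_2-\psi_2)(x_1,x_2,x_3)=\big[l_3'(\varphi_0(x_1),\varphi_0(x_2),\tau(x_3))+l_3'(\mathrm d'\tau(x_1),\tau(x_2),\varphi_0(x_3))+\text{c.p.}\big]-\tau(l_3(x_1,x_2,x_3))+l_3'(\mathrm d'\tau(x_1),\mathrm d'\tau(x_2),\tau(x_3))$, where c.p. means adding the terms obtained from both displayed terms by the cyclic permutations of $x_1,x_2,x_3$. Vertical composition of $\tau:\varphi\Rightarrow\psi$ and $\tau':\psi\Rightarrow\mu$ is $\tau'+\tau$. Horizontal composition of $\tau:\varphi\Rightarrow\psi$ (between maps $\mathcal V\to\mathcal V'$) and $\tau':\varphi'\Rightarrow\psi'$ (between maps $\mathcal V'\to\mathcal V''$) is $x\mapsto\tau'(\varphi_0(x))+\psi_1'(\tau(x))$. Identity $2$-morphisms are zero homotopies. *)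

theory Defs
  imports "HOL-Algebra.Module"
begin

section \<open>Strict 2-categories\<close>

text \<open>
  A (strict) 2-category is given by families \<open>Hom A B\<close> of morphisms and
  \<open>Cell A B f g\<close> of 2-morphisms \<open>f \<Rightarrow> g\<close>.  These families need not be disjoint, so the
  operations take the sources and targets of their arguments as parameters.  Composites are written
  in the usual order: \<open>cmp A B C g f\<close> is \<open>g \<circ> f\<close> for \<open>f : A \<rightarrow> B\<close>, \<open>g : B \<rightarrow> C\<close>;
  \<open>vcmp A B f g h \<beta> \<alpha>\<close> is the vertical composite of \<open>\<alpha> : f \<Rightarrow> g\<close> and \<open>\<beta> : g \<Rightarrow> h\<close>;
  \<open>hcmp A B C f g f' g' \<beta> \<alpha>\<close> is the horizontal composite \<open>f' \<circ> f \<Rightarrow> g' \<circ> g\<close> of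
  \<open>\<alpha> : f \<Rightarrow> g\<close> (between maps \<open>A \<rightarrow> B\<close>) and \<open>\<beta> : f' \<Rightarrow> g'\<close> (between maps \<open>B \<rightarrow> C\<close>).
\<close>

locale two_category =
  fixes Ob :: "'o set"
    and Hom :: "'o \<Rightarrow> 'o \<Rightarrow> 'm set"
    and Cell :: "'o \<Rightarrow> 'o \<Rightarrow> 'm \<Rightarrow> 'm \<Rightarrow> 'c set"
    and ident :: "'o \<Rightarrow> 'm"
    and cmp :: "'o \<Rightarrow> 'o \<Rightarrow> 'o \<Rightarrow> 'm \<Rightarrow> 'm \<Rightarrow> 'm"
    and ident2 :: "'o \<Rightarrow> 'o \<Rightarrow> 'm \<Rightarrow> 'c"
    and vcmp :: "'o \<Rightarrow> 'o \<Rightarrow> 'm \<Rightarrow> 'm \<Rightarrow> 'm \<Rightarrow> 'c \<Rightarrow> 'c \<Rightarrow> 'c"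
    and hcmp :: "'o \<Rightarrow> 'o \<Rightarrow> 'o \<Rightarrow> 'm \<Rightarrow> 'm \<Rightarrow> 'm \<Rightarrow> 'm \<Rightarrow> 'c \<Rightarrow> 'c \<Rightarrow> 'c"
  assumes ident_in: "A \<in> Ob \<Longrightarrow> ident A \<in> Hom A A"
    and cmp_in:
      "\<lbrakk>A \<in> Ob; B \<in> Ob; C \<in> Ob; f \<in> Hom A B; g \<in> Hom B C\<rbrakk> \<Longrightarrow> cmp A B C g f \<in> Hom A C"
    and cmp_ident_right: "\<lbrakk>A \<in> Ob; B \<in> Ob; f \<in> Hom A B\<rbrakk> \<Longrightarrow> cmp A A B f (ident A) = f"
    and cmp_ident_left: "\<lbrakk>A \<in> Ob; B \<in> Ob; f \<in> Hom A B\<rbrakk> \<Longrightarrow> cmp A B B (ident B) f = f"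
    and cmp_assoc:
      "\<lbrakk>A \<in> Ob; B \<in> Ob; C \<in> Ob; D \<in> Ob; f \<in> Hom A B; g \<in> Hom B C; h \<in> Hom C D\<rbrakk>
       \<Longrightarrow> cmp A B D (cmp B C D h g) f = cmp A C D h (cmp A B C g f)"
    and ident2_in: "\<lbrakk>A \<in> Ob; B \<in> Ob; f \<in> Hom A B\<rbrakk> \<Longrightarrow> ident2 A B f \<in> Cell A B f f"
    and vcmp_in:
      "\<lbrakk>A \<in> Ob; B \<in> Ob; f \<in> Hom A B; g \<in> Hom A B; h \<in> Hom A B;
        \<alpha> \<in> Cell A B f g; \<beta> \<in> Cell A B g h\<rbrakk>
       \<Longrightarrow> vcmp A B f g h \<beta> \<alpha> \<in> Cell A B f h"
    and vcmp_ident_right: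
      "\<lbrakk>A \<in> Ob; B \<in> Ob; f \<in> Hom A B; g \<in> Hom A B; \<alpha> \<in> Cell A B f g\<rbrakk>
       \<Longrightarrow> vcmp A B f f g \<alpha> (ident2 A B f) = \<alpha>"
    and vcmp_ident_left:
      "\<lbrakk>A \<in> Ob; B \<in> Ob; f \<in> Hom A B; g \<in> Hom A B; \<alpha> \<in> Cell A B f g\<rbrakk>
       \<Longrightarrow> vcmp A B f g g (ident2 A B g) \<alpha> = \<alpha>"
    and vcmp_assoc:
      "\<lbrakk>A \<in> Ob; B \<in> Ob; f \<in> Hom A B; g \<in> Hom A B; h \<in> Hom A B; k \<in> Hom A B;
        \<alpha> \<in> Cell A B f g; \<beta> \<in> Cell A B g h; \<gamma> \<in> Cell A B h k\<rbrakk>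
       \<Longrightarrow> vcmp A B f g k (vcmp A B g h k \<gamma> \<beta>) \<alpha> = vcmp A B f h k \<gamma> (vcmp A B f g h \<beta> \<alpha>)"
    and hcmp_in:
      "\<lbrakk>A \<in> Ob; B \<in> Ob; C \<in> Ob; f \<in> Hom A B; g \<in> Hom A B; f' \<in> Hom B C; g' \<in> Hom B C;
        \<alpha> \<in> Cell A B f g; \<beta> \<in> Cell B C f' g'\<rbrakk>
       \<Longrightarrow> hcmp A B C f g f' g' \<beta> \<alpha> \<in> Cell A C (cmp A B C f' f) (cmp A B C g' g)"
    and hcmp_ident_right:
      "\<lbrakk>A \<in> Ob; B \<in> Ob; f \<in> Hom A B; g \<in> Hom A B; \<alpha> \<in> Cell A B f g\<rbrakk>
       \<Longrightarrow> hcmp A A B (ident A) (ident A) f g \<alpha> (ident2 A A (ident A)) = \<alpha>"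
    and hcmp_ident_left:
      "\<lbrakk>A \<in> Ob; B \<in> Ob; f \<in> Hom A B; g \<in> Hom A B; \<alpha> \<in> Cell A B f g\<rbrakk>
       \<Longrightarrow> hcmp A B B f g (ident B) (ident B) (ident2 B B (ident B)) \<alpha> = \<alpha>"
    and hcmp_assoc:
      "\<lbrakk>A \<in> Ob; B \<in> Ob; C \<in> Ob; D \<in> Ob; f \<in> Hom A B; g \<in> Hom A B; f' \<in> Hom B C; g' \<in> Hom B C;
        f'' \<in> Hom C D; g'' \<in> Hom C D;
        \<alpha> \<in> Cell A B f g; \<beta> \<in> Cell B C f' g'; \<gamma> \<in> Cell C D f'' g''\<rbrakk>
       \<Longrightarrow> hcmp A B D f g (cmp B C D f'' f') (cmp B C D g'' g') (hcmp B C D f' g' f'' g'' \<gamma> \<beta>) \<alpha>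
         = hcmp A C D (cmp A B C f' f) (cmp A B C g' g) f'' g'' \<gamma> (hcmp A B C f g f' g' \<beta> \<alpha>)"
    and hcmp_ident2:
      "\<lbrakk>A \<in> Ob; B \<in> Ob; C \<in> Ob; f \<in> Hom A B; g \<in> Hom B C\<rbrakk>
       \<Longrightarrow> hcmp A B C f f g g (ident2 B C g) (ident2 A B f) = ident2 A C (cmp A B C g f)"
    and interchange:
      "\<lbrakk>A \<in> Ob; B \<in> Ob; C \<in> Ob; f \<in> Hom A B; g \<in> Hom A B; h \<in> Hom A B;
        f' \<in> Hom B C; g' \<in> Hom B C; h' \<in> Hom B C;
        \<alpha> \<in> Cell A B f g; \<beta> \<in> Cell A B g h; \<alpha>' \<in> Cell B C f' g'; \<beta>' \<in> Cell B C g' h'\<rbrakk>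
       \<Longrightarrow> hcmp A B C f h f' h' (vcmp B C f' g' h' \<beta>' \<alpha>') (vcmp A B f g h \<beta> \<alpha>)
         = vcmp A C (cmp A B C f' f) (cmp A B C g' g) (cmp A B C h' h)
             (hcmp A B C g h g' h' \<beta>' \<beta>) (hcmp A B C f g f' g' \<alpha>' \<alpha>)"

section \<open>Linear and multilinear maps\<close>

text \<open>
  Vector spaces over the field \<open>K\<close> are modules over the ring \<open>K\<close>.  All maps that are part of
  the structures below are extensional (\<open>undefined\<close> off their domain), so that equality in HOL is
  equality of maps between the vector spaces.
\<close>

definition lin :: "('k, 'r) ring_scheme \<Rightarrow> ('k, 'a) module \<Rightarrow> ('k, 'b) module \<Rightarrow> ('a \<Rightarrow> 'b) \<Rightarrow> bool" where
  "lin K U W f \<longleftrightarrow> f \<in> carrier U \<rightarrow> carrier W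
    \<and> (\<forall>x\<in>carrier U. \<forall>y\<in>carrier U. f (x \<oplus>\<^bsub>U\<^esub> y) = f x \<oplus>\<^bsub>W\<^esub> f y)
    \<and> (\<forall>c\<in>carrier K. \<forall>x\<in>carrier U. f (c \<odot>\<^bsub>U\<^esub> x) = c \<odot>\<^bsub>W\<^esub> f x)"

definition linear_maps ::
    "('k, 'r) ring_scheme \<Rightarrow> ('k, 'a) module \<Rightarrow> ('k, 'b) module \<Rightarrow> ('a \<Rightarrow> 'b) set" where
  "linear_maps K U W = {f \<in> extensional (carrier U). lin K U W f}"

definition trilinear_maps ::
    "('k, 'r) ring_scheme \<Rightarrow> ('k, 'a) module \<Rightarrow> ('k, 'b) module \<Rightarrow> ('k, 'c) module
      \<Rightarrow> ('k, 'd) module \<Rightarrow> ('a \<times> 'b \<times> 'c \<Rightarrow> 'd) set" where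
  "trilinear_maps K U1 U2 U3 W =
    {l \<in> extensional (carrier U1 \<times> carrier U2 \<times> carrier U3).
      (\<forall>y\<in>carrier U2. \<forall>z\<in>carrier U3. lin K U1 W (\<lambda>x. l (x, y, z)))
    \<and> (\<forall>x\<in>carrier U1. \<forall>z\<in>carrier U3. lin K U2 W (\<lambda>y. l (x, y, z)))
    \<and> (\<forall>x\<in>carrier U1. \<forall>y\<in>carrier U2. lin K U3 W (\<lambda>z. l (x, y, z)))}"

text \<open>Adjacent transpositions generate the symmetric group, so these two identities express
  complete skew-symmetry.\<close>

definition skew3 :: "('k, 'a) module \<Rightarrow> ('k, 'd) module \<Rightarrow> ('a \<times> 'a \<times> 'a \<Rightarrow> 'd) \<Rightarrow> bool" where
  "skew3 U W l \<longleftrightarrow> (\<forall>x\<in>carrier U. \<forall>y\<in>carrier U. \<forall>z\<in>carrier U.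
     l (y, x, z) = \<ominus>\<^bsub>W\<^esub> l (x, y, z) \<and> l (x, z, y) = \<ominus>\<^bsub>W\<^esub> l (x, y, z))"

text \<open>Linear maps out of \<open>(U \<and> U) \<otimes> (U \<and> U \<and> U)\<close>, as multilinear maps of five arguments that
  are alternating in the first two and in the last three.\<close>

definition wedge23_maps ::
    "('k, 'r) ring_scheme \<Rightarrow> ('k, 'a) module \<Rightarrow> ('k, 'b) module
      \<Rightarrow> ('a \<times> 'a \<times> 'a \<times> 'a \<times> 'a \<Rightarrow> 'b) set" where
  "wedge23_maps K U W =
    {l \<in> extensional (carrier U \<times> carrier U \<times> carrier U \<times> carrier U \<times> carrier U).
      (\<forall>a\<in>carrier U. \<forall>b\<in>carrier U. \<forall>c\<in>carrier U. \<forall>e\<in>carrier U.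
          lin K U W (\<lambda>x. l (x, a, b, c, e))
        \<and> lin K U W (\<lambda>x. l (a, x, b, c, e))
        \<and> lin K U W (\<lambda>x. l (a, b, x, c, e))
        \<and> lin K U W (\<lambda>x. l (a, b, c, x, e))
        \<and> lin K U W (\<lambda>x. l (a, b, c, e, x)))
    \<and> (\<forall>a\<in>carrier U. \<forall>b\<in>carrier U. \<forall>c\<in>carrier U. \<forall>e\<in>carrier U.
          l (a, a, b, c, e) = \<zero>\<^bsub>W\<^esub>
        \<and> l (b, c, a, a, e) = \<zero>\<^bsub>W\<^esub>
        \<and> l (b, c, a, e, a) = \<zero>\<^bsub>W\<^esub>
        \<and> l (b, c, e, a, a) = \<zero>\<^bsub>W\<^esub>)}"

section \<open>2-term 3-Lie-infinity-algebras\<close>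

text \<open>
  The bracket \<open>l\<^sub>3 : V\<^sub>i \<times> V\<^sub>j \<times> V\<^sub>k \<rightarrow> V\<^bsub>i+j+k\<^esub>\<close> is given by one map for each \<open>(i, j, k)\<close>
  with \<open>i + j + k \<le> 1\<close>: \<open>lxxx\<close> on \<open>V\<^sub>0 \<times> V\<^sub>0 \<times> V\<^sub>0\<close>, and \<open>lfxx\<close>, \<open>lxfx\<close>, \<open>lxxf\<close>, where
  \<open>f\<close> marks the position of the argument from \<open>V\<^sub>1\<close>.  The brackets \<open>l\<^sub>3(f, g, h)\<close> and
  \<open>l\<^sub>3(f, g, x)\<close> take values in \<open>V\<^sub>3 = V\<^sub>2 = 0\<close> and carry no data.
\<close>

record ('k, 'a, 'b) lie3_data =
  deg0 :: "('k, 'a) module"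
  deg1 :: "('k, 'b) module"
  dif :: "'b \<Rightarrow> 'a"
  lxxx :: "'a \<times> 'a \<times> 'a \<Rightarrow> 'a"
  lfxx :: "'b \<times> 'a \<times> 'a \<Rightarrow> 'b"
  lxfx :: "'a \<times> 'b \<times> 'a \<Rightarrow> 'b"
  lxxf :: "'a \<times> 'a \<times> 'b \<Rightarrow> 'b"
  l5 :: "'a \<times> 'a \<times> 'a \<times> 'a \<times> 'a \<Rightarrow> 'b"

locale lie3_algebra =
  fixes K :: "('k, 'r) ring_scheme"
    and A :: "('k, 'a) module"
    and B :: "('k, 'b) module"
    and d :: "'b \<Rightarrow> 'a"
    and lxxx :: "'a \<times> 'a \<times> 'a \<Rightarrow> 'a"
    and lfxx :: "'b \<times> 'a \<times> 'a \<Rightarrow> 'b"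
    and lxfx :: "'a \<times> 'b \<times> 'a \<Rightarrow> 'b"
    and lxxf :: "'a \<times> 'a \<times> 'b \<Rightarrow> 'b"
    and l5 :: "'a \<times> 'a \<times> 'a \<times> 'a \<times> 'a \<Rightarrow> 'b"
  assumes field_K: "field K"
    and vs_A: "module K A"
    and vs_B: "module K B"
    and d_linear: "d \<in> linear_maps K B A"
    and lxxx_trilinear: "lxxx \<in> trilinear_maps K A A A A"
    and lfxx_trilinear: "lfxx \<in> trilinear_maps K B A A B"
    and lxfx_trilinear: "lxfx \<in> trilinear_maps K A B A B"
    and lxxf_trilinear: "lxxf \<in> trilinear_maps K A A B B"
    and lxxx_skew: "skew3 A A lxxx"
    and l3_skew:
      "\<lbrakk>x \<in> carrier A; y \<in> carrier A; f \<in> carrier B\<rbrakk> \<Longrightarrow> lxfx (x, f, y) = \<ominus>\<^bsub>B\<^esub> lfxx (f, x, y)"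
      "\<lbrakk>x \<in> carrier A; y \<in> carrier A; f \<in> carrier B\<rbrakk> \<Longrightarrow> lxxf (x, y, f) = \<ominus>\<^bsub>B\<^esub> lxfx (x, f, y)"
      "\<lbrakk>x \<in> carrier A; y \<in> carrier A; f \<in> carrier B\<rbrakk> \<Longrightarrow> lfxx (f, y, x) = \<ominus>\<^bsub>B\<^esub> lfxx (f, x, y)"
      "\<lbrakk>x \<in> carrier A; y \<in> carrier A; f \<in> carrier B\<rbrakk> \<Longrightarrow> lxxf (y, x, f) = \<ominus>\<^bsub>B\<^esub> lxxf (x, y, f)"
    and l5_wedge: "l5 \<in> wedge23_maps K A B"
    and ax_a: "\<lbrakk>x \<in> carrier A; y \<in> carrier A; f \<in> carrier B\<rbrakk> \<Longrightarrow> d (lxxf (x, y, f)) = lxxx (x, y, d f)"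
    and ax_c: "\<lbrakk>f \<in> carrier B; g \<in> carrier B; x \<in> carrier A\<rbrakk> \<Longrightarrow> lxfx (d f, g, x) = lfxx (f, d g, x)"
    and ax_d:
      "\<lbrakk>x1 \<in> carrier A; x2 \<in> carrier A; x3 \<in> carrier A; x4 \<in> carrier A; x5 \<in> carrier A\<rbrakk> \<Longrightarrow>
       d (l5 (x1, x2, x3, x4, x5)) =
         \<ominus>\<^bsub>A\<^esub> lxxx (x1, x2, lxxx (x3, x4, x5))
         \<oplus>\<^bsub>A\<^esub> lxxx (x3, lxxx (x1, x2, x4), x5)
         \<oplus>\<^bsub>A\<^esub> lxxx (lxxx (x1, x2, x3), x4, x5)
         \<oplus>\<^bsub>A\<^esub> lxxx (x3, x4, lxxx (x1, x2, x5))"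
    and ax_e:
      "\<lbrakk>f \<in> carrier B; x2 \<in> carrier A; x3 \<in> carrier A; x4 \<in> carrier A; x5 \<in> carrier A\<rbrakk> \<Longrightarrow>
       l5 (d f, x2, x3, x4, x5) =
         \<ominus>\<^bsub>B\<^esub> lfxx (f, x2, lxxx (x3, x4, x5))
         \<oplus>\<^bsub>B\<^esub> lxfx (x3, lfxx (f, x2, x4), x5)
         \<oplus>\<^bsub>B\<^esub> lfxx (lfxx (f, x2, x3), x4, x5)
         \<oplus>\<^bsub>B\<^esub> lxxf (x3, x4, lfxx (f, x2, x5))"
    and ax_f:
      "\<lbrakk>x1 \<in> carrier A; x2 \<in> carrier A; f \<in> carrier B; x4 \<in> carrier A; x5 \<in> carrier A\<rbrakk> \<Longrightarrow>
       l5 (x1, x2, d f, x4, x5) =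
         \<ominus>\<^bsub>B\<^esub> lxxf (x1, x2, lfxx (f, x4, x5))
         \<oplus>\<^bsub>B\<^esub> lfxx (f, lxxx (x1, x2, x4), x5)
         \<oplus>\<^bsub>B\<^esub> lfxx (lxxf (x1, x2, f), x4, x5)
         \<oplus>\<^bsub>B\<^esub> lfxx (f, x4, lxxx (x1, x2, x5))"
    and ax_g:
      "\<lbrakk>x1 \<in> carrier A; x2 \<in> carrier A; x3 \<in> carrier A; x4 \<in> carrier A; x5 \<in> carrier A;
        x6 \<in> carrier A; x7 \<in> carrier A\<rbrakk> \<Longrightarrow>
         lfxx (l5 (x1, x2, x3, x4, x5), x6, x7)
         \<oplus>\<^bsub>B\<^esub> lxfx (x5, l5 (x1, x2, x3, x4, x6), x7)
         \<oplus>\<^bsub>B\<^esub> lxxf (x1, x2, l5 (x3, x4, x5, x6, x7))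
         \<oplus>\<^bsub>B\<^esub> lxxf (x5, x6, l5 (x1, x2, x3, x4, x7))
         \<oplus>\<^bsub>B\<^esub> l5 (x1, x2, lxxx (x3, x4, x5), x6, x7)
         \<oplus>\<^bsub>B\<^esub> l5 (x1, x2, x5, lxxx (x3, x4, x6), x7)
         \<oplus>\<^bsub>B\<^esub> l5 (x1, x2, x5, x6, lxxx (x3, x4, x7))
       = lxxf (x3, x4, l5 (x1, x2, x5, x6, x7))
         \<oplus>\<^bsub>B\<^esub> l5 (lxxx (x1, x2, x3), x4, x5, x6, x7)
         \<oplus>\<^bsub>B\<^esub> l5 (x3, lxxx (x1, x2, x4), x5, x6, x7)
         \<oplus>\<^bsub>B\<^esub> l5 (x3, x4, lxxx (x1, x2, x5), x6, x7)
         \<oplus>\<^bsub>B\<^esub> l5 (x3, x4, x5, lxxx (x1, x2, x6), x7)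
         \<oplus>\<^bsub>B\<^esub> l5 (x1, x2, x3, x4, lxxx (x5, x6, x7))
         \<oplus>\<^bsub>B\<^esub> l5 (x3, x4, x5, x6, lxxx (x1, x2, x7))"

definition lie3_algebras :: "('k, 'r) ring_scheme \<Rightarrow> ('k, 'a, 'b) lie3_data set" where
  "lie3_algebras K =
    {V. lie3_algebra K (deg0 V) (deg1 V) (dif V) (lxxx V) (lfxx V) (lxfx V) (lxxf V) (l5 V)}"

section \<open>Homomorphisms\<close>

record ('a, 'b, 'c, 'd) lie3_map =
  map0 :: "'a \<Rightarrow> 'c"
  map1 :: "'b \<Rightarrow> 'd"
  map2 :: "'a \<times> 'a \<times> 'a \<Rightarrow> 'd"

definition lie3_homs ::
    "('k, 'r) ring_scheme \<Rightarrow> ('k, 'a, 'b) lie3_data \<Rightarrow> ('k, 'c, 'd) lie3_data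
      \<Rightarrow> ('a, 'b, 'c, 'd) lie3_map set" where
  "lie3_homs K V W = {\<phi>.
      map0 \<phi> \<in> linear_maps K (deg0 V) (deg0 W)
    \<and> map1 \<phi> \<in> linear_maps K (deg1 V) (deg1 W)
    \<and> (\<forall>h\<in>carrier (deg1 V). map0 \<phi> (dif V h) = dif W (map1 \<phi> h))
    \<and> map2 \<phi> \<in> trilinear_maps K (deg0 V) (deg0 V) (deg0 V) (deg1 W)
    \<and> skew3 (deg0 V) (deg1 W) (map2 \<phi>)
    \<and> (\<forall>x1\<in>carrier (deg0 V). \<forall>x2\<in>carrier (deg0 V). \<forall>x3\<in>carrier (deg0 V).
         dif W (map2 \<phi> (x1, x2, x3)) =
           map0 \<phi> (lxxx V (x1, x2, x3)) \<ominus>\<^bsub>deg0 W\<^esub> lxxx W (map0 \<phi> x1, map0 \<phi> x2, map0 \<phi> x3))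
    \<and> (\<forall>x1\<in>carrier (deg0 V). \<forall>x2\<in>carrier (deg0 V). \<forall>h\<in>carrier (deg1 V).
         map2 \<phi> (x1, x2, dif V h) =
           map1 \<phi> (lxxf V (x1, x2, h)) \<ominus>\<^bsub>deg1 W\<^esub> lxxf W (map0 \<phi> x1, map0 \<phi> x2, map1 \<phi> h))
    \<and> (\<forall>x1\<in>carrier (deg0 V). \<forall>x2\<in>carrier (deg0 V). \<forall>x3\<in>carrier (deg0 V).
       \<forall>x4\<in>carrier (deg0 V). \<forall>x5\<in>carrier (deg0 V).
         l5 W (map0 \<phi> x1, map0 \<phi> x2, map0 \<phi> x3, map0 \<phi> x4, map0 \<phi> x5)
         \<oplus>\<^bsub>deg1 W\<^esub> lfxx W (map2 \<phi> (x1, x2, x3), map0 \<phi> x4, map0 \<phi> x5)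
         \<oplus>\<^bsub>deg1 W\<^esub> lxfx W (map0 \<phi> x3, map2 \<phi> (x1, x2, x4), map0 \<phi> x5)
         \<oplus>\<^bsub>deg1 W\<^esub> lxxf W (map0 \<phi> x3, map0 \<phi> x4, map2 \<phi> (x1, x2, x5))
         \<oplus>\<^bsub>deg1 W\<^esub> map2 \<phi> (lxxx V (x1, x2, x3), x4, x5)
         \<oplus>\<^bsub>deg1 W\<^esub> map2 \<phi> (x3, lxxx V (x1, x2, x4), x5)
         \<oplus>\<^bsub>deg1 W\<^esub> map2 \<phi> (x3, x4, lxxx V (x1, x2, x5))
       = lxxf W (map0 \<phi> x1, map0 \<phi> x2, map2 \<phi> (x3, x4, x5))
         \<oplus>\<^bsub>deg1 W\<^esub> map2 \<phi> (x1, x2, lxxx V (x3, x4, x5))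
         \<oplus>\<^bsub>deg1 W\<^esub> map1 \<phi> (l5 V (x1, x2, x3, x4, x5)))}"

definition lie3_id :: "('k, 'a, 'b) lie3_data \<Rightarrow> ('a, 'b, 'a, 'b) lie3_map" where
  "lie3_id V =
    \<lparr>map0 = (\<lambda>x\<in>carrier (deg0 V). x),
     map1 = (\<lambda>h\<in>carrier (deg1 V). h),
     map2 = (\<lambda>_\<in>carrier (deg0 V) \<times> carrier (deg0 V) \<times> carrier (deg0 V). \<zero>\<^bsub>deg1 V\<^esub>)\<rparr>"

definition lie3_comp ::
    "('k, 'a, 'b) lie3_data \<Rightarrow> ('k, 'c, 'd) lie3_data \<Rightarrow> ('k, 'e, 'f) lie3_data
      \<Rightarrow> ('c, 'd, 'e, 'f) lie3_map \<Rightarrow> ('a, 'b, 'c, 'd) lie3_map \<Rightarrow> ('a, 'b, 'e, 'f) lie3_map" where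
  "lie3_comp V V' V'' \<psi> \<phi> =
    \<lparr>map0 = (\<lambda>x\<in>carrier (deg0 V). map0 \<psi> (map0 \<phi> x)),
     map1 = (\<lambda>h\<in>carrier (deg1 V). map1 \<psi> (map1 \<phi> h)),
     map2 = (\<lambda>(x, y, z)\<in>carrier (deg0 V) \<times> carrier (deg0 V) \<times> carrier (deg0 V).
       map2 \<psi> (map0 \<phi> x, map0 \<phi> y, map0 \<phi> z) \<oplus>\<^bsub>deg1 V''\<^esub> map1 \<psi> (map2 \<phi> (x, y, z)))\<rparr>"

section \<open>2-homomorphisms\<close>

definition lie3_2homs ::
    "('k, 'r) ring_scheme \<Rightarrow> ('k, 'a, 'b) lie3_data \<Rightarrow> ('k, 'c, 'd) lie3_data
      \<Rightarrow> ('a, 'b, 'c, 'd) lie3_map \<Rightarrow> ('a, 'b, 'c, 'd) lie3_map \<Rightarrow> ('a \<Rightarrow> 'd) set" where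
  "lie3_2homs K V W \<phi> \<psi> = {\<tau> \<in> linear_maps K (deg0 V) (deg1 W).
      (\<forall>x\<in>carrier (deg0 V). dif W (\<tau> x) = map0 \<psi> x \<ominus>\<^bsub>deg0 W\<^esub> map0 \<phi> x)
    \<and> (\<forall>h\<in>carrier (deg1 V). \<tau> (dif V h) = map1 \<psi> h \<ominus>\<^bsub>deg1 W\<^esub> map1 \<phi> h)
    \<and> (\<forall>x1\<in>carrier (deg0 V). \<forall>x2\<in>carrier (deg0 V). \<forall>x3\<in>carrier (deg0 V).
         map2 \<phi> (x1, x2, x3) \<ominus>\<^bsub>deg1 W\<^esub> map2 \<psi> (x1, x2, x3) =
           (lxxf W (map0 \<phi> x1, map0 \<phi> x2, \<tau> x3)
            \<oplus>\<^bsub>deg1 W\<^esub> lxfx W (dif W (\<tau> x1), \<tau> x2, map0 \<phi> x3)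
            \<oplus>\<^bsub>deg1 W\<^esub> lxxf W (map0 \<phi> x2, map0 \<phi> x3, \<tau> x1)
            \<oplus>\<^bsub>deg1 W\<^esub> lxfx W (dif W (\<tau> x2), \<tau> x3, map0 \<phi> x1)
            \<oplus>\<^bsub>deg1 W\<^esub> lxxf W (map0 \<phi> x3, map0 \<phi> x1, \<tau> x2)
            \<oplus>\<^bsub>deg1 W\<^esub> lxfx W (dif W (\<tau> x3), \<tau> x1, map0 \<phi> x2))
           \<ominus>\<^bsub>deg1 W\<^esub> \<tau> (lxxx V (x1, x2, x3))
           \<oplus>\<^bsub>deg1 W\<^esub> lxxf W (dif W (\<tau> x1), dif W (\<tau> x2), \<tau> x3))}"

definition lie3_id2 ::
    "('k, 'a, 'b) lie3_data \<Rightarrow> ('k, 'c, 'd) lie3_data \<Rightarrow> ('a, 'b, 'c, 'd) lie3_map \<Rightarrow> 'a \<Rightarrow> 'd" where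
  "lie3_id2 V W \<phi> = (\<lambda>x\<in>carrier (deg0 V). \<zero>\<^bsub>deg1 W\<^esub>)"

definition lie3_vcomp ::
    "('k, 'a, 'b) lie3_data \<Rightarrow> ('k, 'c, 'd) lie3_data
      \<Rightarrow> ('a, 'b, 'c, 'd) lie3_map \<Rightarrow> ('a, 'b, 'c, 'd) lie3_map \<Rightarrow> ('a, 'b, 'c, 'd) lie3_map
      \<Rightarrow> ('a \<Rightarrow> 'd) \<Rightarrow> ('a \<Rightarrow> 'd) \<Rightarrow> 'a \<Rightarrow> 'd" where
  "lie3_vcomp V W \<phi> \<psi> \<mu> \<tau>' \<tau> = (\<lambda>x\<in>carrier (deg0 V). \<tau>' x \<oplus>\<^bsub>deg1 W\<^esub> \<tau> x)"

definition lie3_hcomp ::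
    "('k, 'a, 'b) lie3_data \<Rightarrow> ('k, 'c, 'd) lie3_data \<Rightarrow> ('k, 'e, 'f) lie3_data
      \<Rightarrow> ('a, 'b, 'c, 'd) lie3_map \<Rightarrow> ('a, 'b, 'c, 'd) lie3_map
      \<Rightarrow> ('c, 'd, 'e, 'f) lie3_map \<Rightarrow> ('c, 'd, 'e, 'f) lie3_map
      \<Rightarrow> ('c \<Rightarrow> 'f) \<Rightarrow> ('a \<Rightarrow> 'd) \<Rightarrow> 'a \<Rightarrow> 'f" where
  "lie3_hcomp V V' V'' \<phi> \<psi> \<phi>' \<psi>' \<tau>' \<tau> =
    (\<lambda>x\<in>carrier (deg0 V). \<tau>' (map0 \<phi> x) \<oplus>\<^bsub>deg1 V''\<^esub> map1 \<psi>' (\<tau> x))"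

end

(* For a 2-homomorphism tau : phi => psi the bracket terms of the defining identity telescope to
     l3(psi x1, psi x2, tau x3) + l3(psi x1, tau x2, phi x3) + l3(tau x1, phi x2, phi x3),
   a lift along d of l3(psi x1, psi x2, psi x3) - l3(phi x1, phi x2, phi x3). In this form
   closure under vertical composition is the additivity of such lifts, which holds because
   l3(df, g, x) = l3(f, dg, x). A homomorphism whiskers a 2-homomorphism on either side, and a
   horizontal composite is a vertical composite of two whiskerings. Closure of homomorphisms under
   composition comes from adding the coherence identity of psi at phi_0 x_i to psi_1 of that of
   phi, and the remaining axioms are equalities of linear maps checked pointwise. *)

theory Submission
  imports Defs
begin

section \<open>Abelian groups and linear maps\<close>

context abelian_group
begin

text \<open>Adding \<open>b \<oplus> e\<close> to both sides removes the subtractions. The result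
  involves sums only, so associativity and commutativity suffice to normalise it.\<close>

lemma minus_eq_minus_iff:
  assumes "a \<in> carrier G" "b \<in> carrier G" "c \<in> carrier G" "e \<in> carrier G"
  shows "a \<ominus> b = c \<ominus> e \<longleftrightarrow> a \<oplus> e = b \<oplus> c"
proof -
  have "a \<ominus> b = c \<ominus> e \<longleftrightarrow> (a \<ominus> b) \<oplus> (b \<oplus> e) = (c \<ominus> e) \<oplus> (b \<oplus> e)"
    using assms by (simp add: add.right_cancel)
  also have "(a \<ominus> b) \<oplus> (b \<oplus> e) = a \<oplus> e"
    using assms by (simp add: minus_eq a_assoc r_neg1)
  also have "(c \<ominus> e) \<oplus> (b \<oplus> e) = b \<oplus> c"
    using assms by (simp add: minus_eq a_assoc a_comm[of b e] r_neg1) (simp add: a_comm)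
  finally show ?thesis .
qed

lemma eq_minus_iff:
  assumes "a \<in> carrier G" "b \<in> carrier G" "c \<in> carrier G"
  shows "a = b \<ominus> c \<longleftrightarrow> b = c \<oplus> a"
  using add.right_cancel[of c a "b \<ominus> c"] assms by (auto simp: minus_eq a_assoc l_neg a_comm[of c a])

text \<open>Two known equations are added crosswise to the goal: the right sides go to the left of
  the goal and the left sides to the right. What is left to check is a rearrangement of summands. A
  term standing on opposite sides of the two equations drops out without being cancelled by
  hand.\<close>

lemma add_sum_cancel:
  assumes "a = b" "c = e" "x \<oplus> (b \<oplus> e) = y \<oplus> (a \<oplus> c)"
    and "x \<in> carrier G" "y \<in> carrier G" "b \<in> carrier G" "e \<in> carrier G"
  shows "x = y"
  using assms by (simp add: add.right_cancel)

end

section \<open>Linear and trilinear maps and their restrictions to carriers\<close>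

lemma lin_closed: "lin K U W f \<Longrightarrow> x \<in> carrier U \<Longrightarrow> f x \<in> carrier W"
  by (auto simp: lin_def)

lemma lin_add:
  "lin K U W f \<Longrightarrow> x \<in> carrier U \<Longrightarrow> y \<in> carrier U \<Longrightarrow> f (x \<oplus>\<^bsub>U\<^esub> y) = f x \<oplus>\<^bsub>W\<^esub> f y"
  by (auto simp: lin_def)

lemma lin_zero:
  assumes "abelian_group U" "abelian_group W" "lin K U W f"
  shows "f \<zero>\<^bsub>U\<^esub> = \<zero>\<^bsub>W\<^esub>"
proof -
  interpret U: abelian_group U by fact
  interpret W: abelian_group W by fact
  have "f \<zero>\<^bsub>U\<^esub> \<oplus>\<^bsub>W\<^esub> f \<zero>\<^bsub>U\<^esub> = f \<zero>\<^bsub>U\<^esub>"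
    using lin_add[OF assms(3), of "\<zero>\<^bsub>U\<^esub>" "\<zero>\<^bsub>U\<^esub>"] by simp
  then show ?thesis
    using lin_closed[OF assms(3)] by (simp add: W.add.l_cancel_one)
qed

lemma lin_uminus:
  assumes "abelian_group U" "abelian_group W" "lin K U W f" "x \<in> carrier U"
  shows "f (\<ominus>\<^bsub>U\<^esub> x) = \<ominus>\<^bsub>W\<^esub> f x"
proof -
  interpret U: abelian_group U by fact
  interpret W: abelian_group W by fact
  have "f (\<ominus>\<^bsub>U\<^esub> x) \<oplus>\<^bsub>W\<^esub> f x = \<zero>\<^bsub>W\<^esub>"
    using lin_add[OF assms(3), of "\<ominus>\<^bsub>U\<^esub> x" x] lin_zero[OF assms(1-3)] assms(4)
    by (simp add: U.l_neg)
  then show ?thesis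
    using lin_closed[OF assms(3)] assms(4) by (simp add: W.minus_equality)
qed

text \<open>All points at which \<open>lin\<close> compares values lie in the carrier, since a
  module is closed under sums and multiples. Hence linearity of an extensional map can be proved for
  the unrestricted formula.\<close>

lemma lin_cong:
  assumes "module K U" "\<And>x. x \<in> carrier U \<Longrightarrow> f x = g x" "lin K U W f"
  shows "lin K U W g"
proof -
  interpret U: module K U by fact
  show ?thesis
    using assms(2,3) unfolding lin_def by (auto simp flip: assms(2))
qed

lemma lin_plus:
  assumes "module K W" "lin K U W f" "lin K U W g"
  shows "lin K U W (\<lambda>x. f x \<oplus>\<^bsub>W\<^esub> g x)"
proof -
  interpret W: module K W by fact
  show ?thesis
    using assms(2,3) unfolding lin_def
    by (auto simp: W.smult_r_distr Pi_iff W.a_ac)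
qed

lemma lin_comp: "lin K U W f \<Longrightarrow> lin K W X g \<Longrightarrow> lin K U X (\<lambda>x. g (f x))"
  by (auto simp: lin_def Pi_iff)

lemma lin_const_zero: "module K W \<Longrightarrow> lin K U W (\<lambda>_. \<zero>\<^bsub>W\<^esub>)"
  by (auto simp: lin_def module.smult_r_null abelian_group.axioms abelian_monoid.l_zero
      abelian_monoid.zero_closed module_def)

lemma lin_ident: "lin K U U (\<lambda>x. x)"
  by (auto simp: lin_def)

lemma restrict_linear:
  assumes "module K U" "lin K U W f"
  shows "restrict f (carrier U) \<in> linear_maps K U W"
  using assms lin_cong[of K U f "restrict f (carrier U)" W] by (simp add: linear_maps_def)

lemma restrict_trilinear:
  assumes "module K U1" "module K U2" "module K U3"
    and "\<And>y z. y \<in> carrier U2 \<Longrightarrow> z \<in> carrier U3 \<Longrightarrow> lin K U1 W (\<lambda>x. l (x, y, z))"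
    and "\<And>x z. x \<in> carrier U1 \<Longrightarrow> z \<in> carrier U3 \<Longrightarrow> lin K U2 W (\<lambda>y. l (x, y, z))"
    and "\<And>x y. x \<in> carrier U1 \<Longrightarrow> y \<in> carrier U2 \<Longrightarrow> lin K U3 W (\<lambda>z. l (x, y, z))"
  shows "restrict l (carrier U1 \<times> carrier U2 \<times> carrier U3) \<in> trilinear_maps K U1 U2 U3 W"
  unfolding trilinear_maps_def using assms(4-)
  by (auto intro: lin_cong[OF assms(1)] lin_cong[OF assms(2)] lin_cong[OF assms(3)])

lemma trilinear_lin:
  assumes "l \<in> trilinear_maps K U1 U2 U3 W"
  shows "y \<in> carrier U2 \<Longrightarrow> z \<in> carrier U3 \<Longrightarrow> lin K U1 W (\<lambda>x. l (x, y, z))"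
    and "x \<in> carrier U1 \<Longrightarrow> z \<in> carrier U3 \<Longrightarrow> lin K U2 W (\<lambda>y. l (x, y, z))"
    and "x \<in> carrier U1 \<Longrightarrow> y \<in> carrier U2 \<Longrightarrow> lin K U3 W (\<lambda>z. l (x, y, z))"
  using assms by (auto simp: trilinear_maps_def)

lemma trilinear_closed:
  assumes "l \<in> trilinear_maps K U1 U2 U3 W"
    and "x \<in> carrier U1" "y \<in> carrier U2" "z \<in> carrier U3"
  shows "l (x, y, z) \<in> carrier W"
  using lin_closed[OF trilinear_lin(1)[OF assms(1)]] assms(2-) by blast

lemma trilinear_add:
  assumes "l \<in> trilinear_maps K U1 U2 U3 W"
    and "x \<in> carrier U1" "y \<in> carrier U2" "z \<in> carrier U3"
  shows "x' \<in> carrier U1 \<Longrightarrow> l (x \<oplus>\<^bsub>U1\<^esub> x', y, z) = l (x, y, z) \<oplus>\<^bsub>W\<^esub> l (x', y, z)"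
    and "y' \<in> carrier U2 \<Longrightarrow> l (x, y \<oplus>\<^bsub>U2\<^esub> y', z) = l (x, y, z) \<oplus>\<^bsub>W\<^esub> l (x, y', z)"
    and "z' \<in> carrier U3 \<Longrightarrow> l (x, y, z \<oplus>\<^bsub>U3\<^esub> z') = l (x, y, z) \<oplus>\<^bsub>W\<^esub> l (x, y, z')"
  using lin_add[OF trilinear_lin(1)[OF assms(1)]] lin_add[OF trilinear_lin(2)[OF assms(1)]]
    lin_add[OF trilinear_lin(3)[OF assms(1)]] assms(2-) by blast+

section \<open>Objects\<close>

text \<open>The axioms are instantiated at the selectors of one record, so that an object has the
  single name \<open>V\<close> that homomorphisms and their composites refer to.\<close>

locale lie3_object =
  lie3_algebra K "deg0 V" "deg1 V" "dif V" "lxxx V" "lfxx V" "lxfx V" "lxxf V" "l5 V"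
  for K :: "('k, 'r) ring_scheme" and V :: "('k, 'a, 'b) lie3_data"

sublocale lie3_object \<subseteq> M0: module K "deg0 V"
  by (rule vs_A)

sublocale lie3_object \<subseteq> M1: module K "deg1 V"
  by (rule vs_B)

lemma lie3_objectI: "V \<in> lie3_algebras K \<Longrightarrow> lie3_object K V"
  by (simp add: lie3_algebras_def lie3_object_def)

section \<open>Bracket calculus with the degree-one argument in last position\<close>

context lie3_object
begin

lemma ab0: "abelian_group (deg0 V)" and ab1: "abelian_group (deg1 V)"
  by unfold_locales

lemma lin_dif: "lin K (deg1 V) (deg0 V) (dif V)"
  using d_linear by (simp add: linear_maps_def)

lemmas dif_closed [simp] = lin_closed[OF lin_dif]
  and dif_add = lin_add[OF lin_dif]
  and bracket_closed [simp] =
    trilinear_closed[OF lxxx_trilinear] trilinear_closed[OF lfxx_trilinear]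
    trilinear_closed[OF lxfx_trilinear] trilinear_closed[OF lxxf_trilinear]
  and lfxx_add = trilinear_add[OF lfxx_trilinear]
  and lxfx_add = trilinear_add[OF lxfx_trilinear]
  and lxxf_add = trilinear_add[OF lxxf_trilinear]

lemma l5_closed [simp]:
  assumes "x1 \<in> carrier (deg0 V)" "x2 \<in> carrier (deg0 V)" "x3 \<in> carrier (deg0 V)"
    "x4 \<in> carrier (deg0 V)" "x5 \<in> carrier (deg0 V)"
  shows "l5 V (x1, x2, x3, x4, x5) \<in> carrier (deg1 V)"
proof -
  have "lin K (deg0 V) (deg1 V) (\<lambda>x. l5 V (x, x2, x3, x4, x5))"
    using l5_wedge assms by (auto simp: wedge23_maps_def)
  then show ?thesis using lin_closed assms by fast
qed

text \<open>Two adjacent transpositions bring the degree-one argument to the end, and their signs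
  cancel. Together with \<open>lxfx_eq\<close> this makes \<open>lxxf\<close> the normal form of all
  mixed brackets.\<close>

lemma lfxx_eq:
  "\<lbrakk>x \<in> carrier (deg0 V); y \<in> carrier (deg0 V); f \<in> carrier (deg1 V)\<rbrakk>
    \<Longrightarrow> lfxx V (f, x, y) = lxxf V (x, y, f)"
  using l3_skew(1,2)[of x y f] by simp

lemma lxfx_eq:
  "\<lbrakk>x \<in> carrier (deg0 V); y \<in> carrier (deg0 V); f \<in> carrier (deg1 V)\<rbrakk>
    \<Longrightarrow> lxfx V (x, f, y) = \<ominus>\<^bsub>deg1 V\<^esub> lxxf V (x, y, f)"
  using l3_skew(2)[of x y f] by simp

lemma lxxf_swap:
  "\<lbrakk>x \<in> carrier (deg0 V); y \<in> carrier (deg0 V); f \<in> carrier (deg1 V)\<rbrakk>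
    \<Longrightarrow> lxxf V (y, x, f) = \<ominus>\<^bsub>deg1 V\<^esub> lxxf V (x, y, f)"
  by (rule l3_skew(4))

text \<open>This is axiom (c) in the \<open>lxxf\<close> normal form: exchanging which of
  \<open>f\<close> and \<open>g\<close> carries the differential costs a sign, and one more
  transposition of degree-zero arguments removes it. The cross terms of the telescoping arguments
  are matched in this way.\<close>

lemma lxxf_dif_swap:
  assumes "f \<in> carrier (deg1 V)" "g \<in> carrier (deg1 V)" "x \<in> carrier (deg0 V)"
  shows "lxxf V (dif V f, x, g) = \<ominus>\<^bsub>deg1 V\<^esub> lxxf V (dif V g, x, f)"
    and "lxxf V (x, dif V f, g) = lxxf V (dif V g, x, f)"
proof -
  have "\<ominus>\<^bsub>deg1 V\<^esub> lxxf V (dif V f, x, g) = lxxf V (dif V g, x, f)"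
    using ax_c[OF assms] assms by (simp add: lxfx_eq lfxx_eq)
  then show "lxxf V (dif V f, x, g) = \<ominus>\<^bsub>deg1 V\<^esub> lxxf V (dif V g, x, f)"
    using assms by (metis M1.add.inv_inv bracket_closed(4) dif_closed)
  then show "lxxf V (x, dif V f, g) = lxxf V (dif V g, x, f)"
    using assms by (simp add: lxxf_swap[of "dif V f" x])
qed

text \<open>With \<open>b = a + dt\<close>, the right-hand side of the 2-morphism identity is the telescoping lift
  \<open>l\<^sub>3(b\<^sub>1, b\<^sub>2, t\<^sub>3) + l\<^sub>3(b\<^sub>1, t\<^sub>2, a\<^sub>3) + l\<^sub>3(t\<^sub>1, a\<^sub>2, a\<^sub>3)\<close> of
  \<open>l\<^sub>3(b\<^sub>1, b\<^sub>2, b\<^sub>3) - l\<^sub>3(a\<^sub>1, a\<^sub>2, a\<^sub>3)\<close> along \<open>d\<close>; the identity is written here without subtraction.\<close>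

lemma telescope_iff:
  assumes a: "a1 \<in> carrier (deg0 V)" "a2 \<in> carrier (deg0 V)" "a3 \<in> carrier (deg0 V)"
    and t: "t1 \<in> carrier (deg1 V)" "t2 \<in> carrier (deg1 V)" "t3 \<in> carrier (deg1 V)"
    and p: "p \<in> carrier (deg1 V)" "q \<in> carrier (deg1 V)" "r \<in> carrier (deg1 V)"
    and b: "b1 = a1 \<oplus>\<^bsub>deg0 V\<^esub> dif V t1" "b2 = a2 \<oplus>\<^bsub>deg0 V\<^esub> dif V t2"
  shows "p \<ominus>\<^bsub>deg1 V\<^esub> q =
           (lxxf V (a1, a2, t3)
            \<oplus>\<^bsub>deg1 V\<^esub> lxfx V (dif V t1, t2, a3)
            \<oplus>\<^bsub>deg1 V\<^esub> lxxf V (a2, a3, t1)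
            \<oplus>\<^bsub>deg1 V\<^esub> lxfx V (dif V t2, t3, a1)
            \<oplus>\<^bsub>deg1 V\<^esub> lxxf V (a3, a1, t2)
            \<oplus>\<^bsub>deg1 V\<^esub> lxfx V (dif V t3, t1, a2))
           \<ominus>\<^bsub>deg1 V\<^esub> r
           \<oplus>\<^bsub>deg1 V\<^esub> lxxf V (dif V t1, dif V t2, t3)
    \<longleftrightarrow> p \<oplus>\<^bsub>deg1 V\<^esub> (r \<oplus>\<^bsub>deg1 V\<^esub> lxxf V (b1, a3, t2))
        = q \<oplus>\<^bsub>deg1 V\<^esub> (lxxf V (b1, b2, t3) \<oplus>\<^bsub>deg1 V\<^esub> lxxf V (a2, a3, t1))"
    (is "_ = ?rhs \<longleftrightarrow> _ \<oplus>\<^bsub>deg1 V\<^esub> ?Y = _ \<oplus>\<^bsub>deg1 V\<^esub> ?X")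
proof -
  \<comment> \<open>By additivity the bracket on \<open>b1\<close>, \<open>b2\<close> splits into
    four terms and the one on \<open>b1\<close>, \<open>a3\<close> into two. Skew-symmetry matches
    them with the bracket terms of \<open>?rhs\<close>, except that
    \<open>lxfx V (dif V t3, t1, a2)\<close> first needs the differential moved from
    \<open>t3\<close> to \<open>t1\<close>.\<close>
  have "?rhs = ?X \<ominus>\<^bsub>deg1 V\<^esub> ?Y"
    using a t p unfolding b
    by (simp add: lxfx_eq lxxf_add lxxf_swap[of a1 a3] lxxf_swap[of "dif V t2" a1]
        lxxf_dif_swap(1)[of t1 t3] M1.minus_eq M1.minus_add M1.a_ac)
  then show ?thesis
    using a t p unfolding b by (simp add: M1.minus_eq_minus_iff)
qed

text \<open>The telescoping lift is additive along \<open>a \<rightarrow> b \<rightarrow> c\<close>.\<close>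

lemma telescope_trans:
  assumes a: "a2 \<in> carrier (deg0 V)" "a3 \<in> carrier (deg0 V)"
    and b: "b1 \<in> carrier (deg0 V)" "b2 \<in> carrier (deg0 V)"
    and t: "t1 \<in> carrier (deg1 V)" "t2 \<in> carrier (deg1 V)" "t3 \<in> carrier (deg1 V)"
    and s: "s1 \<in> carrier (deg1 V)" "s2 \<in> carrier (deg1 V)" "s3 \<in> carrier (deg1 V)"
    and p: "p \<in> carrier (deg1 V)" "q \<in> carrier (deg1 V)" "w \<in> carrier (deg1 V)"
      "r \<in> carrier (deg1 V)" "r' \<in> carrier (deg1 V)"
    and b2: "b2 = a2 \<oplus>\<^bsub>deg0 V\<^esub> dif V t2" and b3: "b3 = a3 \<oplus>\<^bsub>deg0 V\<^esub> dif V t3"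
    and c: "c1 = b1 \<oplus>\<^bsub>deg0 V\<^esub> dif V s1" "c2 = b2 \<oplus>\<^bsub>deg0 V\<^esub> dif V s2"
    and 1: "p \<oplus>\<^bsub>deg1 V\<^esub> (r \<oplus>\<^bsub>deg1 V\<^esub> lxxf V (b1, a3, t2))
        = q \<oplus>\<^bsub>deg1 V\<^esub> (lxxf V (b1, b2, t3) \<oplus>\<^bsub>deg1 V\<^esub> lxxf V (a2, a3, t1))"
    and 2: "q \<oplus>\<^bsub>deg1 V\<^esub> (r' \<oplus>\<^bsub>deg1 V\<^esub> lxxf V (c1, b3, s2))
        = w \<oplus>\<^bsub>deg1 V\<^esub> (lxxf V (c1, c2, s3) \<oplus>\<^bsub>deg1 V\<^esub> lxxf V (b2, b3, s1))"
  shows "p \<oplus>\<^bsub>deg1 V\<^esub> ((r' \<oplus>\<^bsub>deg1 V\<^esub> r) \<oplus>\<^bsub>deg1 V\<^esub> lxxf V (c1, a3, s2 \<oplus>\<^bsub>deg1 V\<^esub> t2))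
        = w \<oplus>\<^bsub>deg1 V\<^esub> (lxxf V (c1, c2, s3 \<oplus>\<^bsub>deg1 V\<^esub> t3)
            \<oplus>\<^bsub>deg1 V\<^esub> lxxf V (a2, a3, s1 \<oplus>\<^bsub>deg1 V\<^esub> t1))"
proof -
  have cc: "c1 \<in> carrier (deg0 V)" "c2 \<in> carrier (deg0 V)" "b3 \<in> carrier (deg0 V)"
    using a b c s t b3 by simp_all
  \<comment> \<open>The brackets of the goal are expressed through those of \<open>1\<close>
    (\<open>e1\<close>, \<open>e2\<close>), and the brackets of \<open>2\<close> through those of
    the goal (\<open>e3\<close>, \<open>e4\<close>). This leaves three terms with some
    \<open>dif V s\<close> and some \<open>t\<close> on one side, and three with some
    \<open>dif V t\<close> and some \<open>s\<close> on the other.\<close>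
  have e1: "lxxf V (c1, c2, t3)
      = lxxf V (b1, b2, t3) \<oplus>\<^bsub>deg1 V\<^esub> lxxf V (dif V s1, b2, t3) \<oplus>\<^bsub>deg1 V\<^esub> lxxf V (c1, dif V s2, t3)"
    using cc b t s by (simp add: c(2) lxxf_add) (simp add: c(1) lxxf_add)
  have e2: "lxxf V (c1, a3, t2) = lxxf V (b1, a3, t2) \<oplus>\<^bsub>deg1 V\<^esub> lxxf V (dif V s1, a3, t2)"
    using a b t s by (simp add: c lxxf_add)
  have e3: "lxxf V (c1, b3, s2) = lxxf V (c1, a3, s2) \<oplus>\<^bsub>deg1 V\<^esub> lxxf V (c1, dif V t3, s2)"
    using a cc t s by (simp add: b3 lxxf_add)
  have e4: "lxxf V (b2, b3, s1)
      = lxxf V (a2, a3, s1) \<oplus>\<^bsub>deg1 V\<^esub> lxxf V (dif V t2, a3, s1) \<oplus>\<^bsub>deg1 V\<^esub> lxxf V (b2, dif V t3, s1)"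
    using a b cc t s by (simp add: b3 lxxf_add) (simp add: b2 lxxf_add)
  \<comment> \<open>Axiom (c) and skew-symmetry identify the two triples of leftovers up to
    sign.\<close>
  have f: "lxxf V (c1, dif V t3, s2) = \<ominus>\<^bsub>deg1 V\<^esub> lxxf V (c1, dif V s2, t3)"
    "lxxf V (b2, dif V t3, s1) = lxxf V (dif V s1, b2, t3)"
    "lxxf V (dif V t2, a3, s1) = \<ominus>\<^bsub>deg1 V\<^esub> lxxf V (dif V s1, a3, t2)"
    using a b cc t s lxxf_dif_swap(2)[of t3 s2 c1] lxxf_swap[of c1 "dif V s2" t3]
      lxxf_dif_swap(2)[of t3 s1 b2] lxxf_dif_swap(1)[of t2 s1 a3] by simp_all
  note cl = a b cc t s p c[symmetric] b2[symmetric] b3[symmetric]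
  have "(q \<oplus>\<^bsub>deg1 V\<^esub> r' \<oplus>\<^bsub>deg1 V\<^esub> lxxf V (c1, a3, s2)) \<ominus>\<^bsub>deg1 V\<^esub> lxxf V (c1, dif V s2, t3)
      = (w \<oplus>\<^bsub>deg1 V\<^esub> lxxf V (c1, c2, s3) \<oplus>\<^bsub>deg1 V\<^esub> lxxf V (a2, a3, s1)
          \<oplus>\<^bsub>deg1 V\<^esub> lxxf V (dif V s1, b2, t3)) \<ominus>\<^bsub>deg1 V\<^esub> lxxf V (dif V s1, a3, t2)"
    using 2 cl by (simp add: e3 e4 f M1.minus_eq M1.a_ac)
  \<comment> \<open>The negative leftovers change sides, which makes \<open>3\<close> free of
    subtraction. The intermediate \<open>q\<close> is now on the right of \<open>1\<close> and on
    the left of \<open>3\<close>, so it disappears when the two are added.\<close>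
  then have 3: "(q \<oplus>\<^bsub>deg1 V\<^esub> r' \<oplus>\<^bsub>deg1 V\<^esub> lxxf V (c1, a3, s2)) \<oplus>\<^bsub>deg1 V\<^esub> lxxf V (dif V s1, a3, t2)
      = lxxf V (c1, dif V s2, t3) \<oplus>\<^bsub>deg1 V\<^esub> (w \<oplus>\<^bsub>deg1 V\<^esub> lxxf V (c1, c2, s3)
          \<oplus>\<^bsub>deg1 V\<^esub> lxxf V (a2, a3, s1) \<oplus>\<^bsub>deg1 V\<^esub> lxxf V (dif V s1, b2, t3))"
    using cl by (simp add: M1.minus_eq_minus_iff)
  show ?thesis
    by (rule M1.add_sum_cancel[OF 1 3])
      (use cl in \<open>simp_all add: lxxf_add e1 e2 M1.a_ac\<close>)
qed

end

section \<open>Homomorphisms\<close>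

lemma skew3D:
  assumes "skew3 U W l" "x \<in> carrier U" "y \<in> carrier U" "z \<in> carrier U"
  shows "l (y, x, z) = \<ominus>\<^bsub>W\<^esub> l (x, y, z)" "l (x, z, y) = \<ominus>\<^bsub>W\<^esub> l (x, y, z)"
  using assms unfolding skew3_def by blast+

locale lie3_hom = V: lie3_object K V + W: lie3_object K W
  for K :: "('k, 'r) ring_scheme"
    and V :: "('k, 'a, 'b) lie3_data" and W :: "('k, 'c, 'd) lie3_data" +
  fixes \<phi> :: "('a, 'b, 'c, 'd) lie3_map"
  assumes hom: "\<phi> \<in> lie3_homs K V W"
begin

lemmas hom_conjuncts = hom[unfolded lie3_homs_def mem_Collect_eq]

lemma map0_linear_maps: "map0 \<phi> \<in> linear_maps K (deg0 V) (deg0 W)"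
  and map1_linear_maps: "map1 \<phi> \<in> linear_maps K (deg1 V) (deg1 W)"
  and map2_trilinear: "map2 \<phi> \<in> trilinear_maps K (deg0 V) (deg0 V) (deg0 V) (deg1 W)"
  and map2_skew: "skew3 (deg0 V) (deg1 W) (map2 \<phi>)"
  using hom_conjuncts by blast+

lemma map0_dif: "h \<in> carrier (deg1 V) \<Longrightarrow> map0 \<phi> (dif V h) = dif W (map1 \<phi> h)"
  by (rule hom_conjuncts[THEN conjunct2, THEN conjunct2, THEN conjunct1, THEN bspec])

lemma map0_lin: "lin K (deg0 V) (deg0 W) (map0 \<phi>)"
  and map1_lin: "lin K (deg1 V) (deg1 W) (map1 \<phi>)"
  using map0_linear_maps map1_linear_maps by (auto simp: linear_maps_def)

lemmas map_closed [simp] =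
    lin_closed[OF map0_lin] lin_closed[OF map1_lin] trilinear_closed[OF map2_trilinear]
  and map0_add = lin_add[OF map0_lin]
  and map1_add = lin_add[OF map1_lin]
  and map1_zero = lin_zero[OF V.ab1 W.ab1 map1_lin]
  and map1_uminus = lin_uminus[OF V.ab1 W.ab1 map1_lin]
  and map2_add = trilinear_add[OF map2_trilinear]
  and map2_swap = skew3D[OF map2_skew]

text \<open>A 3-cycle is a product of two transpositions, so the signs cancel.\<close>

lemma map2_rotate:
  assumes "x \<in> carrier (deg0 V)" "y \<in> carrier (deg0 V)" "z \<in> carrier (deg0 V)"
  shows "map2 \<phi> (z, x, y) = map2 \<phi> (x, y, z)"
  using map2_swap(1)[of x z y] map2_swap(2)[of x y z] assms by simp

text \<open>The defining equation is solved for the image of the bracket. Used from left to right,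
  it pushes \<open>map0 \<phi>\<close> inside at the cost of a boundary of
  \<open>map2 \<phi>\<close>; \<open>map1_lxxf\<close> does the same in degree one, with a value of
  \<open>map2 \<phi>\<close> at a boundary.\<close>

lemma map0_lxxx:
  assumes "x \<in> carrier (deg0 V)" "y \<in> carrier (deg0 V)" "z \<in> carrier (deg0 V)"
  shows "map0 \<phi> (lxxx V (x, y, z))
    = lxxx W (map0 \<phi> x, map0 \<phi> y, map0 \<phi> z) \<oplus>\<^bsub>deg0 W\<^esub> dif W (map2 \<phi> (x, y, z))"
proof -
  have "dif W (map2 \<phi> (x, y, z))
    = map0 \<phi> (lxxx V (x, y, z)) \<ominus>\<^bsub>deg0 W\<^esub> lxxx W (map0 \<phi> x, map0 \<phi> y, map0 \<phi> z)"
    by (rule hom_conjuncts[THEN conjunct2, THEN conjunct2, THEN conjunct2, THEN conjunct2,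
          THEN conjunct2, THEN conjunct1, rule_format])
      (rule assms)+
  then show ?thesis using assms by (simp add: W.M0.eq_minus_iff)
qed

lemma map1_lxxf:
  assumes "x \<in> carrier (deg0 V)" "y \<in> carrier (deg0 V)" "h \<in> carrier (deg1 V)"
  shows "map1 \<phi> (lxxf V (x, y, h))
    = lxxf W (map0 \<phi> x, map0 \<phi> y, map1 \<phi> h) \<oplus>\<^bsub>deg1 W\<^esub> map2 \<phi> (x, y, dif V h)"
proof -
  have "map2 \<phi> (x, y, dif V h)
    = map1 \<phi> (lxxf V (x, y, h)) \<ominus>\<^bsub>deg1 W\<^esub> lxxf W (map0 \<phi> x, map0 \<phi> y, map1 \<phi> h)"
    by (rule hom_conjuncts[THEN conjunct2, THEN conjunct2, THEN conjunct2, THEN conjunct2,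
          THEN conjunct2, THEN conjunct2, THEN conjunct1, rule_format])
      (rule assms)+
  then show ?thesis using assms by (simp add: W.M1.eq_minus_iff)
qed

text \<open>The definition of a homomorphism only speaks of brackets whose last argument has degree
  one. Skew-symmetry of the brackets and of \<open>map2 \<phi>\<close> transfers it to the other
  positions, all three of which occur in the coherence identity.\<close>

lemma map1_lfxx:
  assumes "x \<in> carrier (deg0 V)" "y \<in> carrier (deg0 V)" "h \<in> carrier (deg1 V)"
  shows "map1 \<phi> (lfxx V (h, x, y))
    = lfxx W (map1 \<phi> h, map0 \<phi> x, map0 \<phi> y) \<oplus>\<^bsub>deg1 W\<^esub> map2 \<phi> (dif V h, x, y)"
  using assms by (simp add: V.lfxx_eq W.lfxx_eq map1_lxxf map2_rotate)

lemma map1_lxfx: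
  assumes "x \<in> carrier (deg0 V)" "y \<in> carrier (deg0 V)" "h \<in> carrier (deg1 V)"
  shows "map1 \<phi> (lxfx V (x, h, y))
    = lxfx W (map0 \<phi> x, map1 \<phi> h, map0 \<phi> y) \<oplus>\<^bsub>deg1 W\<^esub> map2 \<phi> (x, dif V h, y)"
  using assms
  by (simp add: V.lxfx_eq W.lxfx_eq map1_lxxf map1_uminus map2_swap(2)[of x y] W.M1.minus_add)

lemma coherence:
  assumes "x1 \<in> carrier (deg0 V)" "x2 \<in> carrier (deg0 V)" "x3 \<in> carrier (deg0 V)"
    "x4 \<in> carrier (deg0 V)" "x5 \<in> carrier (deg0 V)"
  shows "l5 W (map0 \<phi> x1, map0 \<phi> x2, map0 \<phi> x3, map0 \<phi> x4, map0 \<phi> x5)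
         \<oplus>\<^bsub>deg1 W\<^esub> lfxx W (map2 \<phi> (x1, x2, x3), map0 \<phi> x4, map0 \<phi> x5)
         \<oplus>\<^bsub>deg1 W\<^esub> lxfx W (map0 \<phi> x3, map2 \<phi> (x1, x2, x4), map0 \<phi> x5)
         \<oplus>\<^bsub>deg1 W\<^esub> lxxf W (map0 \<phi> x3, map0 \<phi> x4, map2 \<phi> (x1, x2, x5))
         \<oplus>\<^bsub>deg1 W\<^esub> map2 \<phi> (lxxx V (x1, x2, x3), x4, x5)
         \<oplus>\<^bsub>deg1 W\<^esub> map2 \<phi> (x3, lxxx V (x1, x2, x4), x5)
         \<oplus>\<^bsub>deg1 W\<^esub> map2 \<phi> (x3, x4, lxxx V (x1, x2, x5))
       = lxxf W (map0 \<phi> x1, map0 \<phi> x2, map2 \<phi> (x3, x4, x5))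
         \<oplus>\<^bsub>deg1 W\<^esub> map2 \<phi> (x1, x2, lxxx V (x3, x4, x5))
         \<oplus>\<^bsub>deg1 W\<^esub> map1 \<phi> (l5 V (x1, x2, x3, x4, x5))"
  by (rule hom_conjuncts[THEN conjunct2, THEN conjunct2, THEN conjunct2, THEN conjunct2,
        THEN conjunct2, THEN conjunct2, THEN conjunct2, rule_format]) (rule assms)+

end

lemma lie3_homI: "lie3_object K V \<Longrightarrow> lie3_object K W \<Longrightarrow> \<phi> \<in> lie3_homs K V W \<Longrightarrow> lie3_hom K V W \<phi>"
  by (simp add: lie3_hom_def lie3_hom_axioms_def)

lemma lie3_hom_eqI:
  assumes "lie3_hom K V W \<phi>" "lie3_hom K V W \<psi>"
    and "\<And>x. x \<in> carrier (deg0 V) \<Longrightarrow> map0 \<phi> x = map0 \<psi> x"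
    and "\<And>h. h \<in> carrier (deg1 V) \<Longrightarrow> map1 \<phi> h = map1 \<psi> h"
    and "\<And>x y z. \<lbrakk>x \<in> carrier (deg0 V); y \<in> carrier (deg0 V); z \<in> carrier (deg0 V)\<rbrakk>
      \<Longrightarrow> map2 \<phi> (x, y, z) = map2 \<psi> (x, y, z)"
  shows "\<phi> = \<psi>"
proof -
  interpret F: lie3_hom K V W \<phi> by fact
  interpret G: lie3_hom K V W \<psi> by fact
  have "map0 \<phi> = map0 \<psi>"
    using F.map0_linear_maps G.map0_linear_maps assms(3)
    by (auto simp: linear_maps_def intro: extensionalityI)
  moreover have "map1 \<phi> = map1 \<psi>"
    using F.map1_linear_maps G.map1_linear_maps assms(4)
    by (auto simp: linear_maps_def intro: extensionalityI)
  moreover have "map2 \<phi> = map2 \<psi>"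
    by (rule extensionalityI[where A = "carrier (deg0 V) \<times> carrier (deg0 V) \<times> carrier (deg0 V)"])
      (use F.map2_trilinear G.map2_trilinear assms(5) in \<open>auto simp: trilinear_maps_def\<close>)
  ultimately show ?thesis by simp
qed

text \<open>Since \<open>map2\<close> is zero, every bracket with an entry from \<open>map2\<close>
  vanishes by linearity in that entry, and both sides of the coherence identity reduce to the same
  value of \<open>l5 V\<close>.\<close>

lemma lie3_id_hom:
  assumes "lie3_object K V"
  shows "lie3_hom K V V (lie3_id V)"
proof (rule lie3_homI[OF assms assms])
  interpret lie3_object K V by fact
  show "lie3_id V \<in> lie3_homs K V V"
    unfolding lie3_homs_def lie3_id_def
    using lin_zero[OF ab1 ab1 lin_ident]
    by (auto simp: skew3_def M0.minus_eq M1.minus_eq M0.r_neg M1.r_neg M1.minus_equality[of "\<zero>\<^bsub>deg1 V\<^esub>" "\<zero>\<^bsub>deg1 V\<^esub>"]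
        lin_zero[OF ab1 ab1 trilinear_lin(1)[OF lfxx_trilinear]]
        lin_zero[OF ab1 ab1 trilinear_lin(2)[OF lxfx_trilinear]]
        lin_zero[OF ab1 ab1 trilinear_lin(3)[OF lxxf_trilinear]]
        lin_zero[OF ab1 ab0 lin_dif]
        intro!: restrict_linear[OF vs_A] restrict_linear[OF vs_B] lin_ident
          restrict_trilinear[OF vs_A vs_A vs_A] lin_const_zero[OF vs_B])
qed

lemma lie3_comp_hom:
  assumes "lie3_hom K V V' \<phi>" "lie3_hom K V' V'' \<psi>"
  shows "lie3_hom K V V'' (lie3_comp V V' V'' \<psi> \<phi>)"
proof -
  interpret F: lie3_hom K V V' \<phi> by fact
  interpret G: lie3_hom K V' V'' \<psi> by fact
  let ?\<chi> = "lie3_comp V V' V'' \<psi> \<phi>"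
  have map0: "map0 ?\<chi> x = map0 \<psi> (map0 \<phi> x)" if "x \<in> carrier (deg0 V)" for x
    using that by (simp add: lie3_comp_def)
  have map1: "map1 ?\<chi> x = map1 \<psi> (map1 \<phi> x)" if "x \<in> carrier (deg1 V)" for x
    using that by (simp add: lie3_comp_def)
  have map2: "map2 ?\<chi> (x, y, z) = map2 \<psi> (map0 \<phi> x, map0 \<phi> y, map0 \<phi> z)
      \<oplus>\<^bsub>deg1 V''\<^esub> map1 \<psi> (map2 \<phi> (x, y, z))"
    if "x \<in> carrier (deg0 V)" "y \<in> carrier (deg0 V)" "z \<in> carrier (deg0 V)" for x y z
    using that by (simp add: lie3_comp_def)
  have "map0 ?\<chi> \<in> linear_maps K (deg0 V) (deg0 V'')"
    unfolding lie3_comp_def lie3_map.simps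
    by (intro restrict_linear F.V.vs_A lin_comp[OF F.map0_lin G.map0_lin])
  moreover have "map1 ?\<chi> \<in> linear_maps K (deg1 V) (deg1 V'')"
    unfolding lie3_comp_def lie3_map.simps
    by (intro restrict_linear F.V.vs_B lin_comp[OF F.map1_lin G.map1_lin])
  moreover have "map2 ?\<chi> \<in> trilinear_maps K (deg0 V) (deg0 V) (deg0 V) (deg1 V'')"
    unfolding lie3_comp_def lie3_map.simps
    by (intro restrict_trilinear F.V.vs_A; unfold prod.case; intro lin_plus G.W.vs_B)
      (auto intro: lin_comp[OF F.map0_lin trilinear_lin(1)[OF G.map2_trilinear]]
        lin_comp[OF F.map0_lin trilinear_lin(2)[OF G.map2_trilinear]]
        lin_comp[OF F.map0_lin trilinear_lin(3)[OF G.map2_trilinear]]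
        lin_comp[OF trilinear_lin(1)[OF F.map2_trilinear] G.map1_lin]
        lin_comp[OF trilinear_lin(2)[OF F.map2_trilinear] G.map1_lin]
        lin_comp[OF trilinear_lin(3)[OF F.map2_trilinear] G.map1_lin])
  moreover have "skew3 (deg0 V) (deg1 V'') (map2 ?\<chi>)"
    unfolding skew3_def
  proof (intro ballI conjI)
    fix x y z assume c: "x \<in> carrier (deg0 V)" "y \<in> carrier (deg0 V)" "z \<in> carrier (deg0 V)"
    show "map2 ?\<chi> (y, x, z) = \<ominus>\<^bsub>deg1 V''\<^esub> map2 ?\<chi> (x, y, z)"
      using c by (simp add: map2 F.map2_swap(1)[of x y] G.map2_swap(1)[of "map0 \<phi> x" "map0 \<phi> y"]
          G.map1_uminus G.W.M1.minus_add)
    show "map2 ?\<chi> (x, z, y) = \<ominus>\<^bsub>deg1 V''\<^esub> map2 ?\<chi> (x, y, z)"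
      using c by (simp add: map2 F.map2_swap(2)[of x y] G.map2_swap(2)[of "map0 \<phi> x" "map0 \<phi> y"]
          G.map1_uminus G.W.M1.minus_add)
  qed
  moreover have "map0 ?\<chi> (dif V h) = dif V'' (map1 ?\<chi> h)" if "h \<in> carrier (deg1 V)" for h
    using that by (simp add: map0 map1 F.map0_dif G.map0_dif)
  moreover have "dif V'' (map2 ?\<chi> (x, y, z)) =
      map0 ?\<chi> (lxxx V (x, y, z)) \<ominus>\<^bsub>deg0 V''\<^esub> lxxx V'' (map0 ?\<chi> x, map0 ?\<chi> y, map0 ?\<chi> z)"
    if "x \<in> carrier (deg0 V)" "y \<in> carrier (deg0 V)" "z \<in> carrier (deg0 V)" for x y z
    using that by (simp add: map0 map2 G.W.M0.eq_minus_iff F.map0_lxxx G.map0_lxxx G.map0_add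
        G.map0_dif G.W.dif_add G.W.M0.a_assoc)
  moreover have "map2 ?\<chi> (x, y, dif V h) =
      map1 ?\<chi> (lxxf V (x, y, h)) \<ominus>\<^bsub>deg1 V''\<^esub> lxxf V'' (map0 ?\<chi> x, map0 ?\<chi> y, map1 ?\<chi> h)"
    if "x \<in> carrier (deg0 V)" "y \<in> carrier (deg0 V)" "h \<in> carrier (deg1 V)" for x y h
    using that by (simp add: map0 map1 map2 G.W.M1.eq_minus_iff F.map1_lxxf G.map1_lxxf G.map1_add
        F.map0_dif G.W.M1.a_assoc)
  moreover have "l5 V'' (map0 ?\<chi> x1, map0 ?\<chi> x2, map0 ?\<chi> x3, map0 ?\<chi> x4, map0 ?\<chi> x5)
         \<oplus>\<^bsub>deg1 V''\<^esub> lfxx V'' (map2 ?\<chi> (x1, x2, x3), map0 ?\<chi> x4, map0 ?\<chi> x5)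
         \<oplus>\<^bsub>deg1 V''\<^esub> lxfx V'' (map0 ?\<chi> x3, map2 ?\<chi> (x1, x2, x4), map0 ?\<chi> x5)
         \<oplus>\<^bsub>deg1 V''\<^esub> lxxf V'' (map0 ?\<chi> x3, map0 ?\<chi> x4, map2 ?\<chi> (x1, x2, x5))
         \<oplus>\<^bsub>deg1 V''\<^esub> map2 ?\<chi> (lxxx V (x1, x2, x3), x4, x5)
         \<oplus>\<^bsub>deg1 V''\<^esub> map2 ?\<chi> (x3, lxxx V (x1, x2, x4), x5)
         \<oplus>\<^bsub>deg1 V''\<^esub> map2 ?\<chi> (x3, x4, lxxx V (x1, x2, x5))
       = lxxf V'' (map0 ?\<chi> x1, map0 ?\<chi> x2, map2 ?\<chi> (x3, x4, x5))
         \<oplus>\<^bsub>deg1 V''\<^esub> map2 ?\<chi> (x1, x2, lxxx V (x3, x4, x5))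
         \<oplus>\<^bsub>deg1 V''\<^esub> map1 ?\<chi> (l5 V (x1, x2, x3, x4, x5))"
    if c: "x1 \<in> carrier (deg0 V)" "x2 \<in> carrier (deg0 V)" "x3 \<in> carrier (deg0 V)"
      "x4 \<in> carrier (deg0 V)" "x5 \<in> carrier (deg0 V)" for x1 x2 x3 x4 x5
    \<comment> \<open>The image under \<open>map1 \<psi>\<close> of \<open>l5 V'\<close> at the
      points \<open>map0 \<phi> xi\<close> is on the left of the first identity and on the right of
      the second. Values of \<open>map2 \<psi>\<close> at a boundary of \<open>map2 \<phi>\<close>
      arise in two ways, from pushing \<open>map1 \<psi>\<close> through brackets of
      \<open>V'\<close> and from \<open>map0 \<phi>\<close> of a bracket of \<open>V\<close>, and
      these agree.\<close>
    by (rule G.W.M1.add_sum_cancel[OF arg_cong[where f = "map1 \<psi>", OF F.coherence[OF c]]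
          G.coherence[of "map0 \<phi> x1" "map0 \<phi> x2" "map0 \<phi> x3" "map0 \<phi> x4" "map0 \<phi> x5"]])
      (use c in \<open>simp_all add: map0 map1 map2 F.map0_lxxx G.map1_add G.map2_add G.map1_lfxx
        G.map1_lxfx G.map1_lxxf G.W.lfxx_add G.W.lxfx_add G.W.lxxf_add G.W.M1.a_ac\<close>)
  ultimately have "?\<chi> \<in> lie3_homs K V V''"
    unfolding lie3_homs_def mem_Collect_eq by (intro conjI ballI) assumption+
  then show ?thesis
    by (intro lie3_homI F.V.lie3_object_axioms G.W.lie3_object_axioms)
qed

section \<open>2-homomorphisms\<close>

text \<open>This is the working form of the definition. The target maps are solved for as source
  plus correction, and the 2-morphism identity appears in its telescoped form without
  subtraction.\<close>

lemma lie3_2homs_iff: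
  assumes "lie3_hom K V W \<phi>" "lie3_hom K V W \<psi>"
  shows "\<tau> \<in> lie3_2homs K V W \<phi> \<psi> \<longleftrightarrow> \<tau> \<in> linear_maps K (deg0 V) (deg1 W)
    \<and> (\<forall>x\<in>carrier (deg0 V). map0 \<psi> x = map0 \<phi> x \<oplus>\<^bsub>deg0 W\<^esub> dif W (\<tau> x))
    \<and> (\<forall>h\<in>carrier (deg1 V). map1 \<psi> h = map1 \<phi> h \<oplus>\<^bsub>deg1 W\<^esub> \<tau> (dif V h))
    \<and> (\<forall>x1\<in>carrier (deg0 V). \<forall>x2\<in>carrier (deg0 V). \<forall>x3\<in>carrier (deg0 V).
         map2 \<phi> (x1, x2, x3) \<oplus>\<^bsub>deg1 W\<^esub> (\<tau> (lxxx V (x1, x2, x3))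
           \<oplus>\<^bsub>deg1 W\<^esub> lxxf W (map0 \<psi> x1, map0 \<phi> x3, \<tau> x2))
         = map2 \<psi> (x1, x2, x3) \<oplus>\<^bsub>deg1 W\<^esub> (lxxf W (map0 \<psi> x1, map0 \<psi> x2, \<tau> x3)
           \<oplus>\<^bsub>deg1 W\<^esub> lxxf W (map0 \<phi> x2, map0 \<phi> x3, \<tau> x1)))"
proof -
  interpret F: lie3_hom K V W \<phi> by fact
  interpret G: lie3_hom K V W \<psi> by fact
  have \<tau>: "\<tau> x \<in> carrier (deg1 W)" if "\<tau> \<in> linear_maps K (deg0 V) (deg1 W)" "x \<in> carrier (deg0 V)" for x
    using that lin_closed by (fastforce simp: linear_maps_def)
  show ?thesis
    unfolding lie3_2homs_def mem_Collect_eq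
  proof (intro conj_cong refl ball_cong)
    fix x assume "\<tau> \<in> linear_maps K (deg0 V) (deg1 W)" "x \<in> carrier (deg0 V)"
    then show "dif W (\<tau> x) = map0 \<psi> x \<ominus>\<^bsub>deg0 W\<^esub> map0 \<phi> x
        \<longleftrightarrow> map0 \<psi> x = map0 \<phi> x \<oplus>\<^bsub>deg0 W\<^esub> dif W (\<tau> x)"
      by (simp add: \<tau> F.W.M0.eq_minus_iff)
  next
    fix h assume "\<tau> \<in> linear_maps K (deg0 V) (deg1 W)" "h \<in> carrier (deg1 V)"
    then show "\<tau> (dif V h) = map1 \<psi> h \<ominus>\<^bsub>deg1 W\<^esub> map1 \<phi> h
        \<longleftrightarrow> map1 \<psi> h = map1 \<phi> h \<oplus>\<^bsub>deg1 W\<^esub> \<tau> (dif V h)"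
      by (simp add: \<tau> F.W.M1.eq_minus_iff)
  \<comment> \<open>Here \<open>a\<close> is \<open>map0 \<phi>\<close>, \<open>b\<close> is
    \<open>map0 \<psi>\<close> and \<open>t\<close> is \<tau>. The required equations
    \<open>b = a + dt\<close> come from the earlier conjunct on \<open>map0 \<psi>\<close>, which
    \<open>conj_cong\<close> makes available.\<close>
  qed (rule F.W.telescope_iff; simp add: \<tau>)
qed

section \<open>2-homomorphisms between fixed homomorphisms: identities and vertical
  composition\<close>

locale lie3_cell = F: lie3_hom K V W \<phi> + G: lie3_hom K V W \<psi>
  for K :: "('k, 'r) ring_scheme"
    and V :: "('k, 'a, 'b) lie3_data" and W :: "('k, 'c, 'd) lie3_data"
    and \<phi> :: "('a, 'b, 'c, 'd) lie3_map" and \<psi> :: "('a, 'b, 'c, 'd) lie3_map" +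
  fixes \<tau> :: "'a \<Rightarrow> 'd"
  assumes cell: "\<tau> \<in> lie3_2homs K V W \<phi> \<psi>"
begin

lemmas cell_conjuncts = cell[unfolded lie3_2homs_iff[OF F.lie3_hom_axioms G.lie3_hom_axioms]]

lemma linear: "\<tau> \<in> linear_maps K (deg0 V) (deg1 W)"
  using cell_conjuncts by (rule conjunct1)

lemma lin: "lin K (deg0 V) (deg1 W) \<tau>"
  using linear by (simp add: linear_maps_def)

lemmas closed [simp] = lin_closed[OF lin]
  and add = lin_add[OF lin]

lemma target0: "x \<in> carrier (deg0 V) \<Longrightarrow> map0 \<psi> x = map0 \<phi> x \<oplus>\<^bsub>deg0 W\<^esub> dif W (\<tau> x)"
  by (rule cell_conjuncts[THEN conjunct2, THEN conjunct1, THEN bspec])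

lemma target1: "h \<in> carrier (deg1 V) \<Longrightarrow> map1 \<psi> h = map1 \<phi> h \<oplus>\<^bsub>deg1 W\<^esub> \<tau> (dif V h)"
  by (rule cell_conjuncts[THEN conjunct2, THEN conjunct2, THEN conjunct1, THEN bspec])

lemma telescope:
  assumes "x1 \<in> carrier (deg0 V)" "x2 \<in> carrier (deg0 V)" "x3 \<in> carrier (deg0 V)"
  shows "map2 \<phi> (x1, x2, x3) \<oplus>\<^bsub>deg1 W\<^esub> (\<tau> (lxxx V (x1, x2, x3))
           \<oplus>\<^bsub>deg1 W\<^esub> lxxf W (map0 \<psi> x1, map0 \<phi> x3, \<tau> x2))
         = map2 \<psi> (x1, x2, x3) \<oplus>\<^bsub>deg1 W\<^esub> (lxxf W (map0 \<psi> x1, map0 \<psi> x2, \<tau> x3)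
           \<oplus>\<^bsub>deg1 W\<^esub> lxxf W (map0 \<phi> x2, map0 \<phi> x3, \<tau> x1))"
  by (rule cell_conjuncts[THEN conjunct2, THEN conjunct2, THEN conjunct2, rule_format])
    (rule assms)+

end

lemma lie3_cellI:
  "lie3_hom K V W \<phi> \<Longrightarrow> lie3_hom K V W \<psi> \<Longrightarrow> \<tau> \<in> lie3_2homs K V W \<phi> \<psi> \<Longrightarrow> lie3_cell K V W \<phi> \<psi> \<tau>"
  by (simp add: lie3_cell_def lie3_cell_axioms_def)

text \<open>The underlying map is extensional and does not record its source and target. Allowing
  these to differ on the two sides makes it possible to compare a composite with identities to the
  original 2-homomorphism without first rewriting its boundary.\<close>

lemma lie3_cell_eqI:
  assumes "lie3_cell K V W \<phi> \<psi> \<sigma>" "lie3_cell K V W \<phi>' \<psi>' \<tau>"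
    and "\<And>x. x \<in> carrier (deg0 V) \<Longrightarrow> \<sigma> x = \<tau> x"
  shows "\<sigma> = \<tau>"
  using lie3_cell.linear[OF assms(1)] lie3_cell.linear[OF assms(2)] assms(3)
  by (auto simp: linear_maps_def intro: extensionalityI)

lemma lie3_id2_cell:
  assumes "lie3_hom K V W \<phi>"
  shows "lie3_cell K V W \<phi> \<phi> (lie3_id2 V W \<phi>)"
proof (rule lie3_cellI[OF assms assms])
  interpret lie3_hom K V W \<phi> by fact
  have "lie3_id2 V W \<phi> \<in> linear_maps K (deg0 V) (deg1 W)"
    unfolding lie3_id2_def by (rule restrict_linear[OF V.vs_A lin_const_zero[OF W.vs_B]])
  then show "lie3_id2 V W \<phi> \<in> lie3_2homs K V W \<phi> \<phi>"
    by (simp add: lie3_2homs_iff[OF assms assms])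
      (simp add: lie3_id2_def lin_zero[OF W.ab1 W.ab0 W.lin_dif]
        lin_zero[OF W.ab1 W.ab1 trilinear_lin(3)[OF W.lxxf_trilinear]])
qed

lemma lie3_vcomp_cell:
  assumes "lie3_cell K V W \<phi> \<psi> \<tau>" "lie3_cell K V W \<psi> \<mu> \<tau>'"
  shows "lie3_cell K V W \<phi> \<mu> (lie3_vcomp V W \<phi> \<psi> \<mu> \<tau>' \<tau>)"
proof -
  interpret S: lie3_cell K V W \<phi> \<psi> \<tau> by fact
  interpret T: lie3_cell K V W \<psi> \<mu> \<tau>' by fact
  let ?\<sigma> = "lie3_vcomp V W \<phi> \<psi> \<mu> \<tau>' \<tau>"
  have \<sigma>: "?\<sigma> x = \<tau>' x \<oplus>\<^bsub>deg1 W\<^esub> \<tau> x" if "x \<in> carrier (deg0 V)" for x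
    using that by (simp add: lie3_vcomp_def)
  show ?thesis
  proof (intro lie3_cellI S.F.lie3_hom_axioms T.G.lie3_hom_axioms
      lie3_2homs_iff[OF S.F.lie3_hom_axioms T.G.lie3_hom_axioms, THEN iffD2] conjI ballI)
    show "?\<sigma> \<in> linear_maps K (deg0 V) (deg1 W)"
      unfolding lie3_vcomp_def
      by (intro restrict_linear lin_plus S.F.V.vs_A S.F.W.vs_B S.lin T.lin)
  next
    fix x assume "x \<in> carrier (deg0 V)"
    then show "map0 \<mu> x = map0 \<phi> x \<oplus>\<^bsub>deg0 W\<^esub> dif W (?\<sigma> x)"
      by (simp add: \<sigma> T.target0 S.target0 S.F.W.dif_add S.F.W.M0.a_ac)
  next
    fix h assume "h \<in> carrier (deg1 V)"
    then show "map1 \<mu> h = map1 \<phi> h \<oplus>\<^bsub>deg1 W\<^esub> ?\<sigma> (dif V h)"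
      by (simp add: \<sigma> T.target1 S.target1 S.F.W.M1.a_ac)
  next
    fix x1 x2 x3
    assume x: "x1 \<in> carrier (deg0 V)" "x2 \<in> carrier (deg0 V)" "x3 \<in> carrier (deg0 V)"
    show "map2 \<phi> (x1, x2, x3) \<oplus>\<^bsub>deg1 W\<^esub> (?\<sigma> (lxxx V (x1, x2, x3))
           \<oplus>\<^bsub>deg1 W\<^esub> lxxf W (map0 \<mu> x1, map0 \<phi> x3, ?\<sigma> x2))
         = map2 \<mu> (x1, x2, x3) \<oplus>\<^bsub>deg1 W\<^esub> (lxxf W (map0 \<mu> x1, map0 \<mu> x2, ?\<sigma> x3)
           \<oplus>\<^bsub>deg1 W\<^esub> lxxf W (map0 \<phi> x2, map0 \<phi> x3, ?\<sigma> x1))"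
      unfolding \<sigma>[OF x(1)] \<sigma>[OF x(2)] \<sigma>[OF x(3)] \<sigma>[OF S.F.V.bracket_closed(1)[OF x]]
      \<comment> \<open>The triple \<open>a\<close>, \<open>b\<close>, \<open>c\<close> is
        \<open>map0\<close> of \<phi>, \<psi>, \<mu>, with \<tau> for \<open>t\<close> and
        \<open>\<tau>'\<close> for \<open>s\<close>. The fifteen open positions are carrier
        conditions.\<close>
      by (rule S.F.W.telescope_trans[OF _ _ _ _ _ _ _ _ _ _ _ _ _ _ _
            S.target0[OF x(2)] S.target0[OF x(3)] T.target0[OF x(1)] T.target0[OF x(2)]
            S.telescope[OF x] T.telescope[OF x]])
        (use x in simp_all)
  qed
qed

section \<open>Whiskering and horizontal composition\<close>

lemma whisker_source:
  assumes "lie3_hom K V V' \<phi>" "lie3_cell K V' V'' \<phi>' \<psi>' \<tau>'"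
  shows "lie3_cell K V V'' (lie3_comp V V' V'' \<phi>' \<phi>) (lie3_comp V V' V'' \<psi>' \<phi>)
    (\<lambda>x\<in>carrier (deg0 V). \<tau>' (map0 \<phi> x))"
proof -
  interpret P: lie3_hom K V V' \<phi> by fact
  interpret T: lie3_cell K V' V'' \<phi>' \<psi>' \<tau>' by fact
  note homs = lie3_comp_hom[OF assms(1) T.F.lie3_hom_axioms]
    lie3_comp_hom[OF assms(1) T.G.lie3_hom_axioms]
  show ?thesis
  proof (intro lie3_cellI homs lie3_2homs_iff[OF homs, THEN iffD2] conjI ballI)
    show "(\<lambda>x\<in>carrier (deg0 V). \<tau>' (map0 \<phi> x)) \<in> linear_maps K (deg0 V) (deg1 V'')"
      by (intro restrict_linear P.V.vs_A lin_comp[OF P.map0_lin T.lin])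
  next
    fix x1 x2 x3
    assume x: "x1 \<in> carrier (deg0 V)" "x2 \<in> carrier (deg0 V)" "x3 \<in> carrier (deg0 V)"
    note t = T.telescope[of "map0 \<phi> x1" "map0 \<phi> x2" "map0 \<phi> x3"]
    \<comment> \<open>Since \<open>map0 \<phi>\<close> of a bracket exceeds the bracket of the
      images by a boundary of \<open>map2 \<phi>\<close>, the goal has \<open>?e\<close> on its left
      in addition to \<open>t\<close>. By \<open>target1\<close> for \<open>\<tau>'\<close> this
      equals \<open>map1 \<psi>'\<close> of the value of \<open>map2 \<phi>\<close>, the extra term
      on the right.\<close>
    let ?e = "map1 \<phi>' (map2 \<phi> (x1, x2, x3)) \<oplus>\<^bsub>deg1 V''\<^esub> \<tau>' (dif V' (map2 \<phi> (x1, x2, x3)))"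
    show "map2 (lie3_comp V V' V'' \<phi>' \<phi>) (x1, x2, x3) \<oplus>\<^bsub>deg1 V''\<^esub>
        ((\<lambda>x\<in>carrier (deg0 V). \<tau>' (map0 \<phi> x)) (lxxx V (x1, x2, x3)) \<oplus>\<^bsub>deg1 V''\<^esub>
          lxxf V'' (map0 (lie3_comp V V' V'' \<psi>' \<phi>) x1, map0 (lie3_comp V V' V'' \<phi>' \<phi>) x3,
            (\<lambda>x\<in>carrier (deg0 V). \<tau>' (map0 \<phi> x)) x2))
      = map2 (lie3_comp V V' V'' \<psi>' \<phi>) (x1, x2, x3) \<oplus>\<^bsub>deg1 V''\<^esub>
        (lxxf V'' (map0 (lie3_comp V V' V'' \<psi>' \<phi>) x1, map0 (lie3_comp V V' V'' \<psi>' \<phi>) x2,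
            (\<lambda>x\<in>carrier (deg0 V). \<tau>' (map0 \<phi> x)) x3) \<oplus>\<^bsub>deg1 V''\<^esub>
          lxxf V'' (map0 (lie3_comp V V' V'' \<phi>' \<phi>) x2, map0 (lie3_comp V V' V'' \<phi>' \<phi>) x3,
            (\<lambda>x\<in>carrier (deg0 V). \<tau>' (map0 \<phi> x)) x1))"
      by (rule T.F.W.M1.add_sum_cancel[OF t refl[of ?e]])
        (use x in \<open>simp_all add: lie3_comp_def P.map0_lxxx T.add T.target1 T.F.W.M1.a_ac\<close>)
  qed (simp_all add: lie3_comp_def T.target0 T.target1 P.map0_dif)
qed

text \<open>Applying \<open>map1 \<chi>\<close> to the telescoped identity of \<tau> and pushing it
  through the brackets produces values of \<open>map2 \<chi>\<close> at boundaries
  \<open>dif V' (\<tau> x)\<close>. By trilinearity these account for the change of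
  \<open>map2 \<chi>\<close> from the points \<open>map0 \<phi> xi\<close> to the points
  \<open>map0 \<psi> xi\<close>.\<close>

lemma whisker_target:
  assumes "lie3_cell K V V' \<phi> \<psi> \<tau>" "lie3_hom K V' V'' \<chi>"
  shows "lie3_cell K V V'' (lie3_comp V V' V'' \<chi> \<phi>) (lie3_comp V V' V'' \<chi> \<psi>)
    (\<lambda>x\<in>carrier (deg0 V). map1 \<chi> (\<tau> x))"
proof -
  interpret S: lie3_cell K V V' \<phi> \<psi> \<tau> by fact
  interpret X: lie3_hom K V' V'' \<chi> by fact
  note homs = lie3_comp_hom[OF S.F.lie3_hom_axioms assms(2)]
    lie3_comp_hom[OF S.G.lie3_hom_axioms assms(2)]
  show ?thesis
  proof (intro lie3_cellI homs lie3_2homs_iff[OF homs, THEN iffD2] conjI ballI)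
    show "(\<lambda>x\<in>carrier (deg0 V). map1 \<chi> (\<tau> x)) \<in> linear_maps K (deg0 V) (deg1 V'')"
      by (intro restrict_linear S.F.V.vs_A lin_comp[OF S.lin X.map1_lin])
  next
    fix x1 x2 x3
    assume x: "x1 \<in> carrier (deg0 V)" "x2 \<in> carrier (deg0 V)" "x3 \<in> carrier (deg0 V)"
    let ?a = "map0 \<phi>" and ?b = "map0 \<psi>" and ?dt = "\<lambda>x. dif V' (\<tau> x)"
    \<comment> \<open>The arguments are exchanged one at a time, beginning with the third. Each
      correction is permuted so that its boundary comes last, the position in which
      \<open>map1_lxxf\<close> produces it; for the second argument this costs the sign.\<close>
    have "map2 \<chi> (?b x1, ?b x2, ?b x3)
        = map2 \<chi> (?a x1, ?a x2, ?a x3) \<oplus>\<^bsub>deg1 V''\<^esub> map2 \<chi> (?a x2, ?a x3, ?dt x1)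
          \<oplus>\<^bsub>deg1 V''\<^esub> map2 \<chi> (?b x1, ?b x2, ?dt x3) \<ominus>\<^bsub>deg1 V''\<^esub> map2 \<chi> (?b x1, ?a x3, ?dt x2)"
    proof -
      have "map2 \<chi> (?b x1, ?b x2, ?b x3)
          = map2 \<chi> (?b x1, ?b x2, ?a x3) \<oplus>\<^bsub>deg1 V''\<^esub> map2 \<chi> (?b x1, ?b x2, ?dt x3)"
        using x by (simp add: S.target0[OF x(3)] X.map2_add)
      moreover have "map2 \<chi> (?b x1, ?b x2, ?a x3)
          = map2 \<chi> (?b x1, ?a x2, ?a x3) \<ominus>\<^bsub>deg1 V''\<^esub> map2 \<chi> (?b x1, ?a x3, ?dt x2)"
        using x by (simp add: S.target0[OF x(2)] X.map2_add X.W.M1.minus_eq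
            X.map2_swap(2)[of "?b x1" "?a x3" "?dt x2"])
      moreover have "map2 \<chi> (?b x1, ?a x2, ?a x3)
          = map2 \<chi> (?a x1, ?a x2, ?a x3) \<oplus>\<^bsub>deg1 V''\<^esub> map2 \<chi> (?a x2, ?a x3, ?dt x1)"
        using x by (simp add: S.target0[OF x(1)] X.map2_add X.map2_rotate[of _ _ "?dt x1"])
      ultimately show ?thesis
        using x by (simp add: X.W.M1.minus_eq X.W.M1.a_ac)
    qed
    then have t: "map2 \<chi> (?a x1, ?a x2, ?a x3) \<oplus>\<^bsub>deg1 V''\<^esub> map2 \<chi> (?a x2, ?a x3, ?dt x1)
          \<oplus>\<^bsub>deg1 V''\<^esub> map2 \<chi> (?b x1, ?b x2, ?dt x3)
        = map2 \<chi> (?b x1, ?a x3, ?dt x2) \<oplus>\<^bsub>deg1 V''\<^esub> map2 \<chi> (?b x1, ?b x2, ?b x3)"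
      using x by (subst (asm) X.W.M1.eq_minus_iff) simp_all
    show "map2 (lie3_comp V V' V'' \<chi> \<phi>) (x1, x2, x3) \<oplus>\<^bsub>deg1 V''\<^esub>
        ((\<lambda>x\<in>carrier (deg0 V). map1 \<chi> (\<tau> x)) (lxxx V (x1, x2, x3)) \<oplus>\<^bsub>deg1 V''\<^esub>
          lxxf V'' (map0 (lie3_comp V V' V'' \<chi> \<psi>) x1, map0 (lie3_comp V V' V'' \<chi> \<phi>) x3,
            (\<lambda>x\<in>carrier (deg0 V). map1 \<chi> (\<tau> x)) x2))
      = map2 (lie3_comp V V' V'' \<chi> \<psi>) (x1, x2, x3) \<oplus>\<^bsub>deg1 V''\<^esub>
        (lxxf V'' (map0 (lie3_comp V V' V'' \<chi> \<psi>) x1, map0 (lie3_comp V V' V'' \<chi> \<psi>) x2,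
            (\<lambda>x\<in>carrier (deg0 V). map1 \<chi> (\<tau> x)) x3) \<oplus>\<^bsub>deg1 V''\<^esub>
          lxxf V'' (map0 (lie3_comp V V' V'' \<chi> \<phi>) x2, map0 (lie3_comp V V' V'' \<chi> \<phi>) x3,
            (\<lambda>x\<in>carrier (deg0 V). map1 \<chi> (\<tau> x)) x1))"
      by (rule X.W.M1.add_sum_cancel[OF arg_cong[where f = "map1 \<chi>", OF S.telescope[OF x]] t])
        (use x in \<open>simp_all add: lie3_comp_def X.map1_add X.map1_lxxf X.W.M1.a_ac\<close>)
  qed (simp_all add: lie3_comp_def S.target0 S.target1 X.map0_add X.map1_add X.map0_dif)
qed

lemma lie3_hcomp_cell:
  assumes "lie3_cell K V V' \<phi> \<psi> \<tau>" "lie3_cell K V' V'' \<phi>' \<psi>' \<tau>'"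
  shows "lie3_cell K V V'' (lie3_comp V V' V'' \<phi>' \<phi>) (lie3_comp V V' V'' \<psi>' \<psi>)
    (lie3_hcomp V V' V'' \<phi> \<psi> \<phi>' \<psi>' \<tau>' \<tau>)"
proof -
  interpret S: lie3_cell K V V' \<phi> \<psi> \<tau> by fact
  interpret T: lie3_cell K V' V'' \<phi>' \<psi>' \<tau>' by fact
  note c = lie3_vcomp_cell[OF whisker_source[OF S.F.lie3_hom_axioms assms(2)]
      whisker_target[OF assms(1) T.G.lie3_hom_axioms]]
  \<comment> \<open>The intermediate homomorphism is \<open>\<psi>'\<close> after \<phi>. A vertical
    composite lists the later 2-homomorphism first, so the two summands have to be
    exchanged.\<close>
  have "lie3_vcomp V V'' (lie3_comp V V' V'' \<phi>' \<phi>) (lie3_comp V V' V'' \<psi>' \<phi>)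
        (lie3_comp V V' V'' \<psi>' \<psi>) (\<lambda>x\<in>carrier (deg0 V). map1 \<psi>' (\<tau> x))
        (\<lambda>x\<in>carrier (deg0 V). \<tau>' (map0 \<phi> x))
      = lie3_hcomp V V' V'' \<phi> \<psi> \<phi>' \<psi>' \<tau>' \<tau>"
    unfolding lie3_vcomp_def lie3_hcomp_def
    by (rule restrict_ext) (simp add: T.F.W.M1.a_comm)
  with c show ?thesis by simp
qed

section \<open>Unit, associativity and interchange laws\<close>

lemma lie3_comp_id_right:
  assumes "lie3_hom K V W \<phi>"
  shows "lie3_comp V V W \<phi> (lie3_id V) = \<phi>"
proof -
  interpret lie3_hom K V W \<phi> by fact
  show ?thesis
    by (rule lie3_hom_eqI[OF lie3_comp_hom[OF lie3_id_hom[OF V.lie3_object_axioms] assms] assms])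
      (simp_all add: lie3_comp_def lie3_id_def map1_zero)
qed

lemma lie3_comp_id_left:
  assumes "lie3_hom K V W \<phi>"
  shows "lie3_comp V W W (lie3_id W) \<phi> = \<phi>"
proof -
  interpret lie3_hom K V W \<phi> by fact
  show ?thesis
    by (rule lie3_hom_eqI[OF lie3_comp_hom[OF assms lie3_id_hom[OF W.lie3_object_axioms]] assms])
      (simp_all add: lie3_comp_def lie3_id_def)
qed

lemma lie3_comp_assoc:
  assumes "lie3_hom K V1 V2 \<phi>" "lie3_hom K V2 V3 \<psi>" "lie3_hom K V3 V4 \<chi>"
  shows "lie3_comp V1 V2 V4 (lie3_comp V2 V3 V4 \<chi> \<psi>) \<phi> = lie3_comp V1 V3 V4 \<chi> (lie3_comp V1 V2 V3 \<psi> \<phi>)"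
proof -
  interpret F: lie3_hom K V1 V2 \<phi> by fact
  interpret G: lie3_hom K V2 V3 \<psi> by fact
  interpret H: lie3_hom K V3 V4 \<chi> by fact
  show ?thesis
    by (rule lie3_hom_eqI[OF lie3_comp_hom[OF assms(1) lie3_comp_hom[OF assms(2,3)]]
          lie3_comp_hom[OF lie3_comp_hom[OF assms(1,2)] assms(3)]])
      (simp_all add: lie3_comp_def H.map1_add H.W.M1.a_assoc)
qed

lemma lie3_vcomp_id2:
  assumes "lie3_cell K V W \<phi> \<psi> \<tau>"
  shows "lie3_vcomp V W \<phi> \<phi> \<psi> \<tau> (lie3_id2 V W \<phi>) = \<tau>"
    and "lie3_vcomp V W \<phi> \<psi> \<psi> (lie3_id2 V W \<psi>) \<tau> = \<tau>"
proof -
  interpret lie3_cell K V W \<phi> \<psi> \<tau> by fact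
  show "lie3_vcomp V W \<phi> \<phi> \<psi> \<tau> (lie3_id2 V W \<phi>) = \<tau>"
    by (rule lie3_cell_eqI[OF lie3_vcomp_cell[OF lie3_id2_cell[OF F.lie3_hom_axioms] assms] assms])
      (simp add: lie3_vcomp_def lie3_id2_def)
  show "lie3_vcomp V W \<phi> \<psi> \<psi> (lie3_id2 V W \<psi>) \<tau> = \<tau>"
    by (rule lie3_cell_eqI[OF lie3_vcomp_cell[OF assms lie3_id2_cell[OF G.lie3_hom_axioms]] assms])
      (simp add: lie3_vcomp_def lie3_id2_def)
qed

lemma lie3_vcomp_assoc:
  assumes "lie3_cell K V W \<phi> \<psi> \<rho>" "lie3_cell K V W \<psi> \<mu> \<sigma>" "lie3_cell K V W \<mu> \<nu> \<tau>"
  shows "lie3_vcomp V W \<phi> \<psi> \<nu> (lie3_vcomp V W \<psi> \<mu> \<nu> \<tau> \<sigma>) \<rho>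
    = lie3_vcomp V W \<phi> \<mu> \<nu> \<tau> (lie3_vcomp V W \<phi> \<psi> \<mu> \<sigma> \<rho>)"
proof -
  interpret R: lie3_cell K V W \<phi> \<psi> \<rho> by fact
  interpret S: lie3_cell K V W \<psi> \<mu> \<sigma> by fact
  interpret T: lie3_cell K V W \<mu> \<nu> \<tau> by fact
  show ?thesis
    unfolding lie3_vcomp_def by (rule restrict_ext) (simp add: R.F.W.M1.a_assoc)
qed

lemma lie3_hcomp_id2:
  assumes "lie3_cell K V W \<phi> \<psi> \<tau>"
  shows "lie3_hcomp V V W (lie3_id V) (lie3_id V) \<phi> \<psi> \<tau> (lie3_id2 V V (lie3_id V)) = \<tau>"
    and "lie3_hcomp V W W \<phi> \<psi> (lie3_id W) (lie3_id W) (lie3_id2 W W (lie3_id W)) \<tau> = \<tau>"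
proof -
  interpret lie3_cell K V W \<phi> \<psi> \<tau> by fact
  have id: "lie3_hom K V V (lie3_id V)" "lie3_hom K W W (lie3_id W)"
    by (rule lie3_id_hom[OF F.V.lie3_object_axioms] lie3_id_hom[OF F.W.lie3_object_axioms])+
  show "lie3_hcomp V V W (lie3_id V) (lie3_id V) \<phi> \<psi> \<tau> (lie3_id2 V V (lie3_id V)) = \<tau>"
    by (rule lie3_cell_eqI[OF lie3_hcomp_cell[OF lie3_id2_cell[OF id(1)] assms] assms])
      (simp add: lie3_hcomp_def lie3_id2_def lie3_id_def G.map1_zero)
  show "lie3_hcomp V W W \<phi> \<psi> (lie3_id W) (lie3_id W) (lie3_id2 W W (lie3_id W)) \<tau> = \<tau>"
    by (rule lie3_cell_eqI[OF lie3_hcomp_cell[OF assms lie3_id2_cell[OF id(2)]] assms])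
      (simp add: lie3_hcomp_def lie3_id2_def lie3_id_def)
qed

text \<open>By additivity of \<open>map1 \<psi>''\<close> both sides become a sum of three terms:
  \<tau> after the maps in degree zero of \<phi> and \<open>\<phi>'\<close>,
  \<open>map1 \<psi>''\<close> of \<sigma> after \<open>map0 \<phi>\<close>, and \<rho> followed by
  \<open>map1\<close> of \<open>\<psi>'\<close> and of \<open>\<psi>''\<close>.\<close>

lemma lie3_hcomp_assoc:
  assumes "lie3_cell K V1 V2 \<phi> \<psi> \<rho>" "lie3_cell K V2 V3 \<phi>' \<psi>' \<sigma>" "lie3_cell K V3 V4 \<phi>'' \<psi>'' \<tau>"
  shows "lie3_hcomp V1 V2 V4 \<phi> \<psi> (lie3_comp V2 V3 V4 \<phi>'' \<phi>') (lie3_comp V2 V3 V4 \<psi>'' \<psi>')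
      (lie3_hcomp V2 V3 V4 \<phi>' \<psi>' \<phi>'' \<psi>'' \<tau> \<sigma>) \<rho>
    = lie3_hcomp V1 V3 V4 (lie3_comp V1 V2 V3 \<phi>' \<phi>) (lie3_comp V1 V2 V3 \<psi>' \<psi>) \<phi>'' \<psi>''
      \<tau> (lie3_hcomp V1 V2 V3 \<phi> \<psi> \<phi>' \<psi>' \<sigma> \<rho>)"
proof -
  interpret R: lie3_cell K V1 V2 \<phi> \<psi> \<rho> by fact
  interpret S: lie3_cell K V2 V3 \<phi>' \<psi>' \<sigma> by fact
  interpret T: lie3_cell K V3 V4 \<phi>'' \<psi>'' \<tau> by fact
  show ?thesis
    unfolding lie3_hcomp_def lie3_comp_def
    by (rule restrict_ext) (simp add: T.G.map1_add T.F.W.M1.a_assoc)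
qed

lemma lie3_hcomp_id2_id2:
  assumes "lie3_hom K V V' \<phi>" "lie3_hom K V' V'' \<psi>"
  shows "lie3_hcomp V V' V'' \<phi> \<phi> \<psi> \<psi> (lie3_id2 V' V'' \<psi>) (lie3_id2 V V' \<phi>)
    = lie3_id2 V V'' (lie3_comp V V' V'' \<psi> \<phi>)"
proof -
  interpret F: lie3_hom K V V' \<phi> by fact
  interpret G: lie3_hom K V' V'' \<psi> by fact
  show ?thesis
    unfolding lie3_hcomp_def lie3_id2_def by (rule restrict_ext) (simp add: G.map1_zero)
qed

text \<open>The two sides differ in where \<open>\<tau>'\<close> is evaluated, at
  \<open>map0 \<phi> x\<close> or at \<open>map0 \<psi> x\<close>, and in whether
  \<open>map1 \<mu>'\<close> or \<open>map1 \<psi>'\<close> is applied to \<open>\<sigma> x\<close>.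
  Either change contributes the same term, \<open>\<tau>'\<close> of the boundary of
  \<open>\<sigma> x\<close>.\<close>

lemma lie3_interchange:
  assumes "lie3_cell K V V' \<phi> \<psi> \<sigma>" "lie3_cell K V V' \<psi> \<mu> \<tau>"
    and "lie3_cell K V' V'' \<phi>' \<psi>' \<sigma>'" "lie3_cell K V' V'' \<psi>' \<mu>' \<tau>'"
  shows "lie3_hcomp V V' V'' \<phi> \<mu> \<phi>' \<mu>'
      (lie3_vcomp V' V'' \<phi>' \<psi>' \<mu>' \<tau>' \<sigma>') (lie3_vcomp V V' \<phi> \<psi> \<mu> \<tau> \<sigma>)
    = lie3_vcomp V V'' (lie3_comp V V' V'' \<phi>' \<phi>) (lie3_comp V V' V'' \<psi>' \<psi>) (lie3_comp V V' V'' \<mu>' \<mu>)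
      (lie3_hcomp V V' V'' \<psi> \<mu> \<psi>' \<mu>' \<tau>' \<tau>) (lie3_hcomp V V' V'' \<phi> \<psi> \<phi>' \<psi>' \<sigma>' \<sigma>)"
proof -
  interpret S: lie3_cell K V V' \<phi> \<psi> \<sigma> by fact
  interpret T: lie3_cell K V V' \<psi> \<mu> \<tau> by fact
  interpret S': lie3_cell K V' V'' \<phi>' \<psi>' \<sigma>' by fact
  interpret T': lie3_cell K V' V'' \<psi>' \<mu>' \<tau>' by fact
  show ?thesis
    unfolding lie3_hcomp_def lie3_vcomp_def
    by (rule restrict_ext)
      (simp add: S.target0 T'.target1 T'.add S'.G.map1_add S.F.W.dif_add
          S'.F.W.M1.a_ac)
qed

theorem proposition3p7:
  fixes K :: "('k, 'r) ring_scheme"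
  assumes "field K"
  shows "two_category
    (lie3_algebras K :: ('k, 'a, 'b) lie3_data set)
    (lie3_homs K) (lie3_2homs K)
    lie3_id lie3_comp lie3_id2 lie3_vcomp lie3_hcomp"
  \<comment> \<open>Each axiom is an instance of one lemma above. The introduction rules turn its
    membership premises into the locale predicates that the lemmas assume.\<close>
  by (unfold_locales;
      (rule lie3_hom.hom[OF lie3_id_hom] lie3_hom.hom[OF lie3_comp_hom]
        lie3_comp_id_right lie3_comp_id_left lie3_comp_assoc
        lie3_cell.cell[OF lie3_id2_cell] lie3_cell.cell[OF lie3_vcomp_cell] lie3_vcomp_id2
        lie3_vcomp_assoc lie3_cell.cell[OF lie3_hcomp_cell] lie3_hcomp_id2 lie3_hcomp_assoc
        lie3_hcomp_id2_id2 lie3_interchange;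
       intro lie3_cellI lie3_homI lie3_objectI; assumption))

end
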